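(* For any $\rho>0$ and $\delta\in(0,1)$ there are $\beta>0$ and $C>0$ such that the following holds. For any distribution $D_X\in\mathcal{D}_\rho$ (in any dimension $d$) whose covariance matrix $\Sigma$ satisfies $\Sigma\preceq I$, and for any positive integer $m\le\beta\,\mathrm{tr}(\Sigma)-C$, if $X$ is the $m\times d$ matrix of a sample drawn from $D_X^m$, then \[ \mathbb{P}[\lambda_{\min}(XX^T)\ge m]\ge\delta. \]
   Context: A real random variable $Z$ is sub-Gaussian with relative moment $\rho>0$ if $\mathbb{E}[\exp(tZ)]\le\exp(t^2\rho^2\mathbb{E}[Z^2]/2)$ for all $t\in\mathbb{R}$. A distribution $D_X$ over $\mathbb{R}^d$ is a sub-Gaussian product distribution with relative moment $\rho$ if there is an orthonormal basis $a_1,\dots,a_d$ of $\mathbb{R}^d$ such that, for $X\sim D_X$, the variables $\langle a_i,X\rangle$ are independent and each is sub-Gaussian with relative moment $\rho$. $\mathcal{D}_\rho$ denotes the family of all such distributions, in arbitrary dimension. $\lambda_{\min}$ is the smallest eigenvalue; $\preceq$ is the Loewner order. *)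

theory Defs
  imports "HOL-Probability.Probability"
begin

text \<open>Vectors in R^d are functions nat => real, only coordinates below d matter;
  matrices are functions nat => nat => real with explicit dimensions.\<close>

definition dotp :: "nat \<Rightarrow> (nat \<Rightarrow> real) \<Rightarrow> (nat \<Rightarrow> real) \<Rightarrow> real" where
  "dotp d u v = (\<Sum>k<d. u k * v k)"

definition subgaussian_rel :: "'a measure \<Rightarrow> real \<Rightarrow> ('a \<Rightarrow> real) \<Rightarrow> bool" where
  "subgaussian_rel M \<rho> Z \<longleftrightarrow> Z \<in> borel_measurable M \<and> integrable M (\<lambda>x. (Z x)\<^sup>2) \<and>
     (\<forall>t::real. integrable M (\<lambda>x. exp (t * Z x)) \<and>
        (\<integral>x. exp (t * Z x) \<partial>M) \<le> exp (t\<^sup>2 * \<rho>\<^sup>2 * (\<integral>x. (Z x)\<^sup>2 \<partial>M) / 2))"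

definition distr_Rd :: "nat \<Rightarrow> (nat \<Rightarrow> real) measure \<Rightarrow> bool" where
  "distr_Rd d D \<longleftrightarrow> prob_space D \<and> sets D = sets (PiM {..<d} (\<lambda>_. borel))"

definition subgaussian_product :: "real \<Rightarrow> nat \<Rightarrow> (nat \<Rightarrow> real) measure \<Rightarrow> bool" where
  "subgaussian_product \<rho> d D \<longleftrightarrow> distr_Rd d D \<and>
     (\<exists>a :: nat \<Rightarrow> nat \<Rightarrow> real.
        (\<forall>i<d. \<forall>j<d. dotp d (a i) (a j) = (if i = j then 1 else 0)) \<and>
        prob_space.indep_vars D (\<lambda>_. borel) (\<lambda>i x. dotp d (a i) x) {..<d} \<and>
        (\<forall>i<d. subgaussian_rel D \<rho> (\<lambda>x. dotp d (a i) x)))"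

definition covmat :: "(nat \<Rightarrow> real) measure \<Rightarrow> nat \<Rightarrow> nat \<Rightarrow> real" where
  "covmat D j k = (\<integral>x. x j * x k \<partial>D) - (\<integral>x. x j \<partial>D) * (\<integral>x. x k \<partial>D)"

definition loewner_le_id :: "nat \<Rightarrow> (nat \<Rightarrow> nat \<Rightarrow> real) \<Rightarrow> bool" where
  "loewner_le_id d A \<longleftrightarrow> (\<forall>v::nat \<Rightarrow> real. (\<Sum>j<d. \<Sum>k<d. v j * A j k * v k) \<le> (\<Sum>j<d. (v j)\<^sup>2))"

definition trace_mat :: "nat \<Rightarrow> (nat \<Rightarrow> nat \<Rightarrow> real) \<Rightarrow> real" where
  "trace_mat d A = (\<Sum>j<d. A j j)"

definition is_eigenvalue :: "nat \<Rightarrow> (nat \<Rightarrow> nat \<Rightarrow> real) \<Rightarrow> real \<Rightarrow> bool" where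
  "is_eigenvalue n A k \<longleftrightarrow> (\<exists>v::nat \<Rightarrow> real. (\<exists>i<n. v i \<noteq> 0) \<and>
      (\<forall>i<n. (\<Sum>j<n. A i j * v j) = k * v i))"

definition lambda_min :: "nat \<Rightarrow> (nat \<Rightarrow> nat \<Rightarrow> real) \<Rightarrow> real" where
  "lambda_min n A = Min {k. is_eigenvalue n A k}"

text \<open>X X^T for the m x d sample matrix whose i-th row is S i.\<close>
definition gram :: "nat \<Rightarrow> (nat \<Rightarrow> nat \<Rightarrow> real) \<Rightarrow> nat \<Rightarrow> nat \<Rightarrow> real" where
  "gram d S i l = dotp d (S i) (S l)"

end

theory Submission
  imports Defs "Jordan_Normal_Form.Char_Poly"
begin

text \<open>For a fixed vector \<open>v\<close>, the number \<open>|X\<^sup>T v|\<^sup>2\<close> is the sum over \<open>i\<close> of the squares of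
  \<open>\<Sum>j. v j * \<langle>a i, X j\<rangle>\<close>, which are independent sub-Gaussian variables with total variance
  \<open>|v|\<^sup>2 tr \<Sigma>\<close>. As the individual variances are at most \<open>1\<close>, Chernoff bounds show that for
  \<open>1/2 \<le> |v| \<le> 1\<close> it lies between \<open>tr \<Sigma> / 16\<close> and \<open>4 \<rho>\<^sup>2 tr \<Sigma>\<close> except with probability exponentially
  small in \<open>tr \<Sigma>\<close>. A union bound makes this hold simultaneously on an \<open>\<epsilon>\<close>-net of the unit ball
  with \<open>exp (O(m))\<close> points, provided that \<open>m\<close> is at most a small multiple of \<open>tr \<Sigma>\<close>. The upper
  bound on the net controls the operator norm of \<open>X\<^sup>T\<close>, and this norm transfers the lower bound from
  the net to the whole unit sphere.\<close>

section \<open>Orthonormal bases and the smallest eigenvalue\<close>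

text \<open>The lower tail is the delicate one: it needs the fourth moment of a combination to be
  bounded by a multiple of its squared variance, and a sub-Gaussian proxy proportional to the second
  moment provides exactly that. The individual variance bounds let one Chernoff parameter, depending
  on \<rho> only, serve all coordinates at once. The net consists of rounded lattice points, which
  lie in the ball but not on the sphere; hence the range of norms instead of norm 1. On the net,
  upper and lower bound for |X^T v| are both multiples of the square root of the trace, so the mesh
  \<epsilon> needed to compare them depends on \<rho> alone. The net exponent and \<beta> then
  depend on \<rho> alone as well, and \<delta> enters only through C. Two points of rigour: the
  distribution is not assumed centred, but the exponential moment bound forces mean zero, so second
  moments are variances; and the final event must be shown measurable, because
  \<open>measure\<close> is 0 on all other sets.\<close>

lemma orthonormal_columns:
  assumes orth: "\<forall>i<d. \<forall>j<d. dotp d (a i) (a j) = (if i = j then 1 else 0)"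
    and "j < d" "k < d"
  shows "(\<Sum>i<d. a i j * a i k) = (if j = k then 1 else 0)"
proof -
  define A where "A = mat d d (\<lambda>(i, j). a i j)"
  have A: "A \<in> carrier_mat d d" by (simp add: A_def)
  have "A * transpose_mat A = 1\<^sub>m d"
    using orth by (intro eq_matI)
      (auto simp: A_def scalar_prod_def dotp_def lessThan_atLeast0)
  then have "transpose_mat A * A = 1\<^sub>m d"
    by (intro mat_mult_left_right_inverse[OF A]) (use A in auto)
  then have "(transpose_mat A * A) $$ (j, k) = (1\<^sub>m d :: real mat) $$ (j, k)"
    by simp
  then show ?thesis
    using assms(2,3) by (simp add: A_def scalar_prod_def lessThan_atLeast0)
qed

text \<open>\<open>Min\<close> is meaningful only on finite nonempty sets. Finiteness holds because
  eigenvalues are roots of the characteristic polynomial, which is monic and hence nonzero.\<close>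

lemma finite_eigenvalues: "finite {k. is_eigenvalue n A k}"
proof -
  define B where "B = mat n n (\<lambda>(i, j). A i j)"
  have B: "B \<in> carrier_mat n n" by (simp add: B_def)
  have "{k. is_eigenvalue n A k} \<subseteq> {k. poly (char_poly B) k = 0}"
  proof safe
    fix k assume "is_eigenvalue n A k"
    then obtain v i where i: "i < n" "v i \<noteq> 0"
      and v: "\<forall>i<n. (\<Sum>j<n. A i j * v j) = k * v i"
      unfolding is_eigenvalue_def by blast
    have "eigenvector B (vec n v) k"
      unfolding eigenvector_def
    proof (intro conjI)
      show "vec n v \<noteq> 0\<^sub>v (dim_row B)"
        using i B by (metis carrier_matD(1) index_vec index_zero_vec(1))
      show "B *\<^sub>v vec n v = k \<cdot>\<^sub>v vec n v"
        using v by (intro eq_vecI) (auto simp: B_def scalar_prod_def lessThan_atLeast0)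
    qed (simp add: B_def)
    then show "poly (char_poly B) k = 0"
      using eigenvalue_root_char_poly[OF B] by (auto simp: eigenvalue_def)
  qed
  moreover have "char_poly B \<noteq> 0"
    using degree_monic_char_poly[OF B] by (metis leading_coeff_0_iff zero_neq_one)
  ultimately show ?thesis
    using poly_roots_finite finite_subset by blast
qed

section \<open>Variational characterization of the smallest eigenvalue\<close>

lemma continuous_on_quadratic_form:
  fixes G :: "nat \<Rightarrow> nat \<Rightarrow> real"
  shows "continuous_on S (\<lambda>v. \<Sum>i<n. \<Sum>j<n. v i * G i j * v j)"
  by (intro continuous_intros continuous_on_subset[OF continuous_on_product_coordinates]) auto

lemma continuous_on_square_norm:
  shows "continuous_on S (\<lambda>v::nat \<Rightarrow> real. \<Sum>i<n. (v i)\<^sup>2)"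
  by (intro continuous_intros continuous_on_subset[OF continuous_on_product_coordinates]) auto

text \<open>The topology on functions is the product topology. Fixing the coordinates from
  \<open>n\<close> on to be 0 puts the sphere inside a product of compact intervals, so Tychonoff
  applies; with those coordinates free it would not be compact.\<close>

lemma compact_unit_sphere:
  "compact {v::nat \<Rightarrow> real. (\<forall>i\<ge>n. v i = 0) \<and> (\<Sum>i<n. (v i)\<^sup>2) = 1}"
proof -
  define K where "K = PiE UNIV (\<lambda>i. if i < n then {-1..1} else {0::real})"
  have "compact K"
    using compactin_PiE[of "\<lambda>_::nat. euclideanreal" UNIV "\<lambda>i. if i < n then {-1..1} else {0::real}"]
    by (simp add: K_def euclidean_product_topology)
  moreover have "closed {v::nat \<Rightarrow> real. (\<Sum>i<n. (v i)\<^sup>2) = 1}"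
    by (intro closed_Collect_eq continuous_on_square_norm continuous_on_const)
  moreover have "{v::nat \<Rightarrow> real. (\<forall>i\<ge>n. v i = 0) \<and> (\<Sum>i<n. (v i)\<^sup>2) = 1}
      = K \<inter> {v. (\<Sum>i<n. (v i)\<^sup>2) = 1}"
  proof safe
    fix v :: "nat \<Rightarrow> real"
    assume v: "\<forall>i\<ge>n. v i = 0" "(\<Sum>i<n. (v i)\<^sup>2) = 1"
    have "\<bar>v i\<bar> \<le> 1" if "i < n" for i
    proof -
      have "(v i)\<^sup>2 \<le> (\<Sum>i<n. (v i)\<^sup>2)"
        using that by (intro member_le_sum) auto
      then show ?thesis using v by (simp add: abs_square_le_1)
    qed
    then show "v \<in> K" using v by (auto simp: K_def abs_le_iff minus_le_iff)
  next
    fix v :: "nat \<Rightarrow> real" and i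
    assume "v \<in> K" "n \<le> i"
    have "v i \<in> (if i < n then {-1..1} else {0})"
      using \<open>v \<in> K\<close> unfolding K_def by (rule PiE_mem) simp
    then show "v i = 0" using \<open>n \<le> i\<close> by simp
  qed
  ultimately show ?thesis by (simp add: compact_Int_closed)
qed

text \<open>A minimizer \<open>u\<close> of the form on the unit sphere is an eigenvector.
  Subtracting \<open>q u\<close> times the squared norm leaves a positive semidefinite form that
  vanishes at \<open>u\<close>, and such a form has \<open>u\<close> in its kernel. Testing against
  the standard basis vectors gives the eigenvalue equation.\<close>

lemma Rayleigh_minimizer:
  fixes G :: "nat \<Rightarrow> nat \<Rightarrow> real"
  assumes "n \<ge> 1" and sym: "\<And>i j. G i j = G j i"
  shows "\<exists>\<mu>. is_eigenvalue n G \<mu> \<and>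
    (\<forall>v. \<mu> * (\<Sum>i<n. (v i)\<^sup>2) \<le> (\<Sum>i<n. \<Sum>j<n. v i * G i j * v j))"
proof -
  define q where "q v = (\<Sum>i<n. \<Sum>j<n. v i * G i j * v j)" for v :: "nat \<Rightarrow> real"
  define S where "S = {v::nat \<Rightarrow> real. (\<forall>i\<ge>n. v i = 0) \<and> (\<Sum>i<n. (v i)\<^sup>2) = 1}"
  have "(\<lambda>i. if i = 0 then 1 else 0) \<in> S"
    using assms(1) by (auto simp: S_def if_distrib[of "\<lambda>x. x\<^sup>2"] cong: if_cong)
  then have "S \<noteq> {}" by blast
  then obtain u where u: "u \<in> S" and umin: "\<And>v. v \<in> S \<Longrightarrow> q u \<le> q v"
    using continuous_attains_inf[of S q] compact_unit_sphere[of n]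
      continuous_on_quadratic_form[where S=S and n=n and G=G] unfolding S_def q_def by blast
  have uu: "(\<Sum>i<n. (u i)\<^sup>2) = 1" using u by (simp add: S_def)
  have le: "q u * (\<Sum>i<n. (v i)\<^sup>2) \<le> q v" for v
  proof (cases "(\<Sum>i<n. (v i)\<^sup>2) = 0")
    case True
    then have "v i = 0" if "i < n" for i
      using that by (simp add: sum_nonneg_eq_0_iff)
    then show ?thesis using True by (simp add: q_def)
  next
    case False
    define r where "r = sqrt (\<Sum>i<n. (v i)\<^sup>2)"
    have r2: "r\<^sup>2 = (\<Sum>i<n. (v i)\<^sup>2)" by (simp add: r_def sum_nonneg)
    have r: "r > 0" using False by (simp add: r_def sum_nonneg less_le)
    define w where "w i = (if i < n then v i / r else 0)" for i
    have "(\<Sum>i<n. (w i)\<^sup>2) = (\<Sum>i<n. (v i)\<^sup>2) / r\<^sup>2"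
      by (simp add: w_def power_divide sum_divide_distrib)
    then have "w \<in> S" using r2 False by (simp add: S_def w_def)
    then have "q u \<le> q w" by (rule umin)
    also have "q w = q v / r\<^sup>2"
      unfolding q_def sum_divide_distrib
      by (intro sum.cong refl) (simp add: w_def power2_eq_square)
    finally show ?thesis using r by (simp add: r2[symmetric] field_simps)
  qed
  define B where "B v w = (\<Sum>i<n. \<Sum>j<n. v i * G i j * w j) - q u * (\<Sum>i<n. v i * w i)"
    for v w :: "nat \<Rightarrow> real"
  have B_nonneg: "0 \<le> B v v" for v
    using le[of v] by (simp add: B_def q_def power2_eq_square)
  have Buu: "B u u = 0" using uu by (simp add: B_def q_def power2_eq_square)
  have B_sym: "B v w = B w v" for v w
  proof -
    have "(\<Sum>i<n. \<Sum>j<n. v i * G i j * w j) = (\<Sum>j<n. \<Sum>i<n. v i * G i j * w j)"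
      by (rule sum.swap)
    also have "\<dots> = (\<Sum>j<n. \<Sum>i<n. w j * G j i * v i)"
      by (intro sum.cong refl) (use sym in \<open>simp add: mult_ac\<close>)
    finally show ?thesis by (simp add: B_def mult.commute)
  qed
  have B_add: "B (\<lambda>i. v i + t * w i) z = B v z + t * B w z" for v w z t
    by (simp add: B_def algebra_simps sum.distrib sum_distrib_left)
  have Bu: "B w u = 0" for w
  proof (rule ccontr)
    assume nz: "B w u \<noteq> 0"
    have "0 \<le> 2 * t * B w u + t\<^sup>2 * B w w" for t
    proof -
      have "0 \<le> B (\<lambda>i. u i + t * w i) (\<lambda>i. u i + t * w i)" by (rule B_nonneg)
      also have "\<dots> = B (\<lambda>i. u i + t * w i) u + t * B (\<lambda>i. u i + t * w i) w"
        by (subst B_add) (simp only: B_sym[of _ "\<lambda>i. u i + t * w i"])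
      also have "\<dots> = 2 * t * B w u + t\<^sup>2 * B w w"
        by (simp only: B_add Buu B_sym[of u w]) (simp add: power2_eq_square algebra_simps)
      finally show ?thesis .
    qed
    note * = this
    \<comment> \<open>At t = \<open>- x * B w u\<close> the quadratic in t is negative, because x *
      B w w \<le> 1 < 2. The summand 1 in the denominator covers the case B w w = 0.\<close>
    define x where "x = 1 / (1 + B w w)"
    have pos: "1 + B w w > 0" using B_nonneg[of w] by linarith
    have x: "x > 0" "x * B w w \<le> 1"
      using pos B_nonneg[of w] by (auto simp: x_def field_simps)
    have "0 \<le> 2 * (- x * B w u) * B w u + (- x * B w u)\<^sup>2 * B w w" by (rule *)
    also have "\<dots> = x * (B w u)\<^sup>2 * (x * B w w - 2)"
      by (simp add: power2_eq_square algebra_simps)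
    also have "\<dots> < 0"
      using x nz by (intro mult_pos_neg) auto
    finally show False by simp
  qed
  have "is_eigenvalue n G (q u)"
    unfolding is_eigenvalue_def
  proof (intro exI[of _ u] conjI allI impI)
    show "\<exists>i<n. u i \<noteq> 0"
    proof (rule ccontr)
      assume "\<not> (\<exists>i<n. u i \<noteq> 0)"
      then have "(\<Sum>i<n. (u i)\<^sup>2) = 0" by simp
      then show False using uu by simp
    qed
  next
    fix k assume k: "k < n"
    have "B (\<lambda>i. if i = k then 1 else 0) u = (\<Sum>j<n. G k j * u j) - q u * u k"
    proof -
      have "(\<Sum>i<n. \<Sum>j<n. (if i = k then 1 else 0) * G i j * u j)
        = (\<Sum>i<n. if i = k then (\<Sum>j<n. G k j * u j) else 0)"
        by (intro sum.cong refl) auto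
      moreover have "(\<Sum>i<n. (if i = k then 1 else 0) * u i) = (\<Sum>i<n. if i = k then u k else 0)"
        by (intro sum.cong refl) auto
      ultimately show ?thesis using k by (simp add: B_def)
    qed
    then show "(\<Sum>j<n. G k j * u j) = q u * u k" using Bu by simp
  qed
  then show ?thesis using le unfolding q_def by blast
qed

text \<open>Replaces eigenvalues by a family of inequalities, which suits both the net argument and
  measurability. Symmetry guarantees a real eigenvalue, so that \<open>Min\<close> is not taken over
  the empty set.\<close>

lemma lambda_min_ge_iff:
  fixes G :: "nat \<Rightarrow> nat \<Rightarrow> real"
  assumes "n \<ge> 1" and sym: "\<And>i j. G i j = G j i"
  shows "c \<le> lambda_min n G \<longleftrightarrow>
    (\<forall>v. c * (\<Sum>i<n. (v i)\<^sup>2) \<le> (\<Sum>i<n. \<Sum>j<n. v i * G i j * v j))"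
proof
  assume c: "c \<le> lambda_min n G"
  obtain \<mu> where \<mu>: "is_eigenvalue n G \<mu>"
    and le: "\<And>v. \<mu> * (\<Sum>i<n. (v i)\<^sup>2) \<le> (\<Sum>i<n. \<Sum>j<n. v i * G i j * v j)"
    using Rayleigh_minimizer[where G = G, OF assms] by blast
  have "lambda_min n G \<le> \<mu>"
    unfolding lambda_min_def using \<mu> finite_eigenvalues by (intro Min_le) auto
  then have "c \<le> \<mu>" using c by simp
  then show "\<forall>v. c * (\<Sum>i<n. (v i)\<^sup>2) \<le> (\<Sum>i<n. \<Sum>j<n. v i * G i j * v j)"
    by (intro allI order_trans[OF mult_right_mono le] sum_nonneg) auto
next
  assume q: "\<forall>v. c * (\<Sum>i<n. (v i)\<^sup>2) \<le> (\<Sum>i<n. \<Sum>j<n. v i * G i j * v j)"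
  have "c \<le> k" if k: "is_eigenvalue n G k" for k
  proof -
    obtain v i where i: "i < n" "v i \<noteq> 0"
      and v: "\<forall>i<n. (\<Sum>j<n. G i j * v j) = k * v i"
      using k unfolding is_eigenvalue_def by blast
    have "c * (\<Sum>i<n. (v i)\<^sup>2) \<le> (\<Sum>i<n. \<Sum>j<n. v i * G i j * v j)"
      using q by blast
    also have "\<dots> = (\<Sum>i<n. v i * (\<Sum>j<n. G i j * v j))"
      by (simp add: sum_distrib_left mult.assoc)
    also have "\<dots> = k * (\<Sum>i<n. (v i)\<^sup>2)"
      using v by (simp add: sum_distrib_left power2_eq_square mult_ac)
    finally have "c * (\<Sum>i<n. (v i)\<^sup>2) \<le> k * (\<Sum>i<n. (v i)\<^sup>2)" .
    moreover have "(\<Sum>i<n. (v i)\<^sup>2) > 0"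
      using i by (intro sum_pos2[of _ i]) auto
    ultimately show ?thesis by simp
  qed
  then have "\<forall>k\<in>{k. is_eigenvalue n G k}. c \<le> k" by blast
  moreover have "{k. is_eigenvalue n G k} \<noteq> {}"
    using Rayleigh_minimizer[where G = G, OF assms] by blast
  ultimately show "c \<le> lambda_min n G"
    unfolding lambda_min_def using Min_in[OF finite_eigenvalues] by blast
qed

section \<open>Nets of the unit ball\<close>

text \<open>\<open>R\<close> bounds the squared norm. Extensionality fixes the values outside the
  first \<open>m\<close> coordinates, so that the points can be counted.\<close>

definition lattice_ball :: "nat \<Rightarrow> real \<Rightarrow> (nat \<Rightarrow> int) set" where
  "lattice_ball m R = {k \<in> extensional {..<m}. (\<Sum>j<m. (of_int (k j))\<^sup>2) \<le> R}"

text \<open>The subtracted term carries the induction; later only the limit 3 matters, as the price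
  per coordinate in the count of lattice points.\<close>

lemma sum_half_power_abs_le: "(\<Sum>k\<in>{- int n..int n}. (1 / 2 :: real) ^ nat \<bar>k\<bar>) \<le> 3 - 2 * (1 / 2) ^ n"
proof (induction n)
  case (Suc n)
  have "{- int (Suc n)..int (Suc n)} = insert (int (Suc n)) (insert (- int (Suc n)) {- int n..int n})"
    by auto
  then have "(\<Sum>k\<in>{- int (Suc n)..int (Suc n)}. (1 / 2 :: real) ^ nat \<bar>k\<bar>)
      = 2 * (1 / 2) ^ Suc n + (\<Sum>k\<in>{- int n..int n}. (1 / 2) ^ nat \<bar>k\<bar>)"
    by (simp add: nat_add_distrib)
  then show ?case using Suc by simp
qed simp

text \<open>Integers satisfy |k| \<le> k^2, and e is at least 2.\<close>

lemma exp_neg_square_le_half_power: "exp (- (of_int k)\<^sup>2) \<le> (1 / 2 :: real) ^ nat \<bar>k\<bar>"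
proof -
  have "\<bar>k\<bar> \<le> k\<^sup>2"
    by (cases "k = 0") (auto simp: power2_eq_square abs_mult_self_eq[of k, symmetric] simp del: abs_mult_self_eq)
  then have "real_of_int \<bar>k\<bar> \<le> real_of_int (k\<^sup>2)" by (rule of_int_le_iff[THEN iffD2])
  then have "exp (- (of_int k)\<^sup>2) \<le> exp (real (nat \<bar>k\<bar>) * (- 1))" by simp
  also have "\<dots> = exp (- 1) ^ nat \<bar>k\<bar>" by (rule exp_of_nat_mult)
  also have "\<dots> \<le> (1 / 2) ^ nat \<bar>k\<bar>"
  proof (intro power_mono)
    have "exp (1 :: real) \<ge> 2" using exp_ge_add_one_self[of "1 :: real"] by simp
    then show "exp (- 1 :: real) \<le> 1 / 2" by (simp add: exp_minus field_simps)
  qed simp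
  finally show ?thesis .
qed

text \<open>A Chernoff-type count: since \<open>exp (- k\<^sup>2) \<le> (1/2)\<^bsup>|k|\<^esup>\<close>, each point of the ball has weight at least
  \<open>1\<close> under \<open>exp R * (\<Prod>j. (1/2)\<^bsup>|k j|\<^esup>)\<close>, whose sum over all points factorizes.\<close>

lemma lattice_ball_finite_card:
  "finite (lattice_ball m R)" "real (card (lattice_ball m R)) \<le> exp R * 3 ^ m"
proof -
  define n where "n = nat \<lceil>R\<rceil>"
  define w where "w k = (\<Prod>j<m. (1 / 2 :: real) ^ nat \<bar>k j\<bar>)" for k :: "nat \<Rightarrow> int"
  have sub: "lattice_ball m R \<subseteq> PiE {..<m} (\<lambda>_. {- int n..int n})"
  proof
    fix k assume k: "k \<in> lattice_ball m R"
    have "k j \<in> {- int n..int n}" if j: "j < m" for j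
    proof -
      have "(of_int (k j))\<^sup>2 \<le> (\<Sum>j<m. (of_int (k j))\<^sup>2 :: real)"
        using j by (intro member_le_sum) auto
      then have "of_int ((k j)\<^sup>2) \<le> R" using k by (simp add: lattice_ball_def)
      then have "(k j)\<^sup>2 \<le> int n" unfolding n_def by linarith
      moreover have "\<bar>k j\<bar> \<le> (k j)\<^sup>2"
        by (cases "k j = 0") (auto simp: power2_eq_square abs_mult_self_eq[of "k j", symmetric] simp del: abs_mult_self_eq)
      ultimately show ?thesis by auto
    qed
    then show "k \<in> PiE {..<m} (\<lambda>_. {- int n..int n})"
      using k by (auto simp: lattice_ball_def PiE_iff)
  qed
  then show fin: "finite (lattice_ball m R)"
    by (rule finite_subset) (auto intro: finite_PiE)
  have weight: "1 \<le> exp R * w k" if k: "k \<in> lattice_ball m R" for k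
  proof -
    have "exp (- R) \<le> exp (\<Sum>j<m. - (of_int (k j))\<^sup>2)"
      using k by (simp add: lattice_ball_def sum_negf)
    also have "\<dots> = (\<Prod>j<m. exp (- (of_int (k j))\<^sup>2))" by (simp add: exp_sum)
    also have "\<dots> \<le> w k"
      unfolding w_def by (intro prod_mono) (auto intro: exp_neg_square_le_half_power)
    finally have "exp R * exp (- R) \<le> exp R * w k" by (intro mult_left_mono) auto
    then show ?thesis by (simp add: exp_minus)
  qed
  have "real (card (lattice_ball m R)) = (\<Sum>k\<in>lattice_ball m R. 1)" by simp
  also have "\<dots> \<le> (\<Sum>k\<in>lattice_ball m R. exp R * w k)"
    by (intro sum_mono weight)
  also have "\<dots> \<le> (\<Sum>k\<in>PiE {..<m} (\<lambda>_. {- int n..int n}). exp R * w k)"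
  proof (rule sum_mono2[OF _ sub])
    show "finite (PiE {..<m} (\<lambda>_. {- int n..int n}))" by (intro finite_PiE) auto
    show "0 \<le> exp R * w k" for k
      unfolding w_def by (intro mult_nonneg_nonneg prod_nonneg) auto
  qed
  also have "\<dots> = exp R * (\<Prod>j<m. \<Sum>k\<in>{- int n..int n}. (1 / 2) ^ nat \<bar>k\<bar>)"
    unfolding w_def sum_distrib_left[symmetric] by (subst prod_sum_PiE) auto
  also have "\<dots> \<le> exp R * (\<Prod>j<m. 3)"
  proof (intro mult_left_mono prod_mono conjI)
    show "(\<Sum>k\<in>{- int n..int n}. (1 / 2 :: real) ^ nat \<bar>k\<bar>) \<le> 3"
      using sum_half_power_abs_le[of n] by (rule order_trans) simp
  qed (auto intro: sum_nonneg)
  finally show "real (card (lattice_ball m R)) \<le> exp R * 3 ^ m" by simp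
qed

text \<open>With this mesh a lattice cell has diagonal \<epsilon>. In integer coordinates the unit
  ball has squared radius m / \<epsilon>^2, which explains the recurring argument of
  \<open>lattice_ball\<close> and makes the logarithm of the size of the net linear in m.\<close>

definition net_point :: "nat \<Rightarrow> real \<Rightarrow> (nat \<Rightarrow> int) \<Rightarrow> nat \<Rightarrow> real" where
  "net_point m \<epsilon> k j = \<epsilon> / sqrt (real m) * of_int (k j)"

lemma net_point_norm_le:
  assumes "m \<ge> 1" "\<epsilon> > 0" "k \<in> lattice_ball m (real m / \<epsilon>\<^sup>2)"
  shows "(\<Sum>j<m. (net_point m \<epsilon> k j)\<^sup>2) \<le> 1"
proof -
  have "(\<Sum>j<m. (net_point m \<epsilon> k j)\<^sup>2) = \<epsilon>\<^sup>2 / real m * (\<Sum>j<m. (of_int (k j))\<^sup>2)"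
    by (simp add: net_point_def power_mult_distrib power_divide sum_distrib_left)
  also have "\<dots> \<le> \<epsilon>\<^sup>2 / real m * (real m / \<epsilon>\<^sup>2)"
    using assms by (intro mult_left_mono) (auto simp: lattice_ball_def)
  also have "\<dots> = 1" using assms by simp
  finally show ?thesis .
qed

text \<open>Rounding towards zero keeps the rounded point inside the ball.\<close>

lemma ex_net_point:
  fixes u :: "nat \<Rightarrow> real"
  assumes "m \<ge> 1" "\<epsilon> > 0" and u: "(\<Sum>j<m. (u j)\<^sup>2) \<le> 1"
  shows "\<exists>k\<in>lattice_ball m (real m / \<epsilon>\<^sup>2). (\<Sum>j<m. (u j - net_point m \<epsilon> k j)\<^sup>2) \<le> \<epsilon>\<^sup>2"
proof -
  define y where "y j = u j * sqrt (real m) / \<epsilon>" for j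
  define k where "k = (\<lambda>j\<in>{..<m}. if y j \<ge> 0 then \<lfloor>y j\<rfloor> else \<lceil>y j\<rceil>)"
  have le: "(of_int (k j))\<^sup>2 \<le> (y j)\<^sup>2" and diff: "(y j - of_int (k j))\<^sup>2 \<le> 1" if "j < m" for j
  proof -
    have "\<bar>of_int (k j)\<bar> \<le> \<bar>y j\<bar>" "\<bar>y j - of_int (k j)\<bar> \<le> 1"
      using that unfolding k_def by (auto; linarith)+
    then show "(of_int (k j))\<^sup>2 \<le> (y j)\<^sup>2" "(y j - of_int (k j))\<^sup>2 \<le> 1"
      by (simp_all add: abs_le_square_iff abs_square_le_1)
  qed
  have "(\<Sum>j<m. (of_int (k j))\<^sup>2) \<le> (\<Sum>j<m. (y j)\<^sup>2)"
    by (intro sum_mono le) simp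
  also have "\<dots> = real m / \<epsilon>\<^sup>2 * (\<Sum>j<m. (u j)\<^sup>2)"
    by (simp add: y_def power_mult_distrib power_divide sum_distrib_left mult_ac)
  also have "\<dots> \<le> real m / \<epsilon>\<^sup>2 * 1" by (intro mult_left_mono u) simp
  finally have "k \<in> lattice_ball m (real m / \<epsilon>\<^sup>2)"
    by (simp add: lattice_ball_def k_def)
  moreover have "(\<Sum>j<m. (u j - net_point m \<epsilon> k j)\<^sup>2) \<le> \<epsilon>\<^sup>2"
  proof -
    have "u j - net_point m \<epsilon> k j = \<epsilon> / sqrt (real m) * (y j - of_int (k j))" for j
      using assms(1,2) by (simp add: net_point_def y_def field_simps)
    then have "(\<Sum>j<m. (u j - net_point m \<epsilon> k j)\<^sup>2) = \<epsilon>\<^sup>2 / real m * (\<Sum>j<m. (y j - of_int (k j))\<^sup>2)"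
      by (simp add: power_mult_distrib power_divide sum_distrib_left)
    also have "\<dots> \<le> \<epsilon>\<^sup>2 / real m * (\<Sum>j<m. 1)"
      by (intro mult_left_mono sum_mono diff) auto
    also have "\<dots> = \<epsilon>\<^sup>2" using assms(1) by simp
    finally show ?thesis .
  qed
  ultimately show ?thesis by blast
qed

section \<open>From a net to the whole ball and sphere\<close>

definition image_norm :: "nat \<Rightarrow> nat \<Rightarrow> (nat \<Rightarrow> nat \<Rightarrow> real) \<Rightarrow> (nat \<Rightarrow> real) \<Rightarrow> real" where
  "image_norm d m Y u = L2_set (\<lambda>i. \<Sum>j<m. u j * Y i j) {..<d}"

lemma image_norm_square:
  "(image_norm d m Y u)\<^sup>2 = (\<Sum>i<d. (\<Sum>j<m. u j * Y i j)\<^sup>2)"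
  by (simp add: image_norm_def L2_set_def sum_nonneg)

lemma image_norm_triangle:
  "image_norm d m Y (\<lambda>j. u j + v j) \<le> image_norm d m Y u + image_norm d m Y v"
  unfolding image_norm_def using L2_set_triangle_ineq[of "\<lambda>i. \<Sum>j<m. u j * Y i j" "\<lambda>i. \<Sum>j<m. v j * Y i j"]
  by (simp add: distrib_right sum.distrib)

lemma image_norm_scale:
  "image_norm d m Y (\<lambda>j. c * u j) = \<bar>c\<bar> * image_norm d m Y u"
proof -
  have "(\<Sum>i<d. (\<Sum>j<m. c * u j * Y i j)\<^sup>2) = c\<^sup>2 * (\<Sum>i<d. (\<Sum>j<m. u j * Y i j)\<^sup>2)"
    by (simp add: sum_distrib_left power_mult_distrib[symmetric] mult.assoc)
  then show ?thesis by (simp add: image_norm_def L2_set_def real_sqrt_mult)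
qed

lemma image_norm_nonneg: "image_norm d m Y u \<ge> 0"
  by (simp add: image_norm_def)

text \<open>Used with \<open>Y i j\<close> the i-th basis coordinate of sample point j, so that
  \<open>image_norm\<close> is the norm of X^T u. Writing a vector of the ball as a net point plus
  \<epsilon> times another vector of the ball shows that the supremum s satisfies s \<le> b +
  \<epsilon> s, hence s \<le> 2 b.\<close>

lemma image_norm_le_net_bound:
  assumes "m \<ge> 1" "0 < \<epsilon>" "\<epsilon> \<le> 1 / 2"
    and net: "\<And>k. k \<in> lattice_ball m (real m / \<epsilon>\<^sup>2) \<Longrightarrow> image_norm d m Y (net_point m \<epsilon> k) \<le> b"
    and u: "(\<Sum>j<m. (u j)\<^sup>2) \<le> 1"
  shows "image_norm d m Y u \<le> 2 * b"
proof -
  define B where "B = {u::nat \<Rightarrow> real. (\<Sum>j<m. (u j)\<^sup>2) \<le> 1}"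
  define s where "s = (SUP u\<in>B. image_norm d m Y u)"
  \<comment> \<open>A crude bound suffices: it only makes the supremum a genuine upper bound,
    without which the inequality for s says nothing.\<close>
  have bdd: "bdd_above (image_norm d m Y ` B)"
  proof (rule bdd_aboveI2)
    fix u assume "u \<in> B"
    then have u: "(\<Sum>j<m. (u j)\<^sup>2) \<le> 1" by (simp add: B_def)
    have u1: "\<bar>u j\<bar> \<le> 1" if "j < m" for j
    proof -
      have "(u j)\<^sup>2 \<le> (\<Sum>j<m. (u j)\<^sup>2)" using that by (intro member_le_sum) auto
      then show ?thesis using u by (simp add: abs_square_le_1[symmetric])
    qed
    have "image_norm d m Y u \<le> (\<Sum>i<d. \<bar>\<Sum>j<m. u j * Y i j\<bar>)"
      unfolding image_norm_def by (rule L2_set_le_sum_abs)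
    also have "\<dots> \<le> (\<Sum>i<d. \<Sum>j<m. \<bar>u j * Y i j\<bar>)"
      by (intro sum_mono sum_abs)
    also have "\<dots> \<le> (\<Sum>i<d. \<Sum>j<m. \<bar>Y i j\<bar>)"
      by (intro sum_mono) (auto simp: abs_mult mult_left_le_one_le u1)
    finally show "image_norm d m Y u \<le> (\<Sum>i<d. \<Sum>j<m. \<bar>Y i j\<bar>)" .
  qed
  have s: "image_norm d m Y u \<le> s" if "u \<in> B" for u
    unfolding s_def using that bdd by (rule cSUP_upper)
  have "image_norm d m Y u \<le> b + \<epsilon> * s" if u: "u \<in> B" for u
  proof -
    obtain k where k: "k \<in> lattice_ball m (real m / \<epsilon>\<^sup>2)"
      and e: "(\<Sum>j<m. (u j - net_point m \<epsilon> k j)\<^sup>2) \<le> \<epsilon>\<^sup>2"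
      using ex_net_point[of m \<epsilon> u] assms u by (auto simp: B_def)
    define z where "z j = (u j - net_point m \<epsilon> k j) / \<epsilon>" for j
    have "(\<Sum>j<m. (z j)\<^sup>2) = (\<Sum>j<m. (u j - net_point m \<epsilon> k j)\<^sup>2) / \<epsilon>\<^sup>2"
      by (simp add: z_def power_divide sum_divide_distrib)
    then have "z \<in> B" using e assms(2) by (simp add: B_def)
    \<comment> \<open>An equality at all indices: \<open>z\<close> is defined for every j, so the
      two sides agree beyond m whatever \<open>k\<close> is there.\<close>
    have "u = (\<lambda>j. net_point m \<epsilon> k j + \<epsilon> * z j)"
      using assms(2) by (simp add: z_def)
    then have "image_norm d m Y u \<le> image_norm d m Y (net_point m \<epsilon> k) + image_norm d m Y (\<lambda>j. \<epsilon> * z j)"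
      using image_norm_triangle[of d m Y "net_point m \<epsilon> k" "\<lambda>j. \<epsilon> * z j"] by simp
    also have "\<dots> \<le> b + \<epsilon> * s"
      using net[OF k] s[OF \<open>z \<in> B\<close>] assms(2) by (simp add: image_norm_scale add_mono)
    finally show ?thesis .
  qed
  moreover have "B \<noteq> {}" by (auto simp: B_def intro!: exI[of _ "\<lambda>_. 0"])
  ultimately have "s \<le> b + \<epsilon> * s" unfolding s_def by (intro cSUP_least) (auto simp: s_def)
  moreover have "0 \<le> s"
    using s[of "\<lambda>_. 0"] image_norm_nonneg[of d m Y "\<lambda>_. 0"] by (simp add: B_def)
  then have "\<epsilon> * s \<le> 1 / 2 * s" using assms(3) by (intro mult_right_mono)
  ultimately have "s \<le> 2 * b" by linarith
  then show ?thesis using s[of u] u by (simp add: B_def)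
qed

text \<open>By homogeneity a unit vector is enough. A net point within \<epsilon> \<le> 1/2 of it
  has norm at least 1/2, so the lower bound \<open>a\<close> is available there, and the error,
  \<epsilon> times a vector of the ball, has image of norm at most \<epsilon> * 2 b by the previous
  lemma.\<close>

lemma image_norm_ge_net_bound:
  assumes "m \<ge> 1" "0 < \<epsilon>" "\<epsilon> \<le> 1 / 2"
    and upper: "\<And>k. k \<in> lattice_ball m (real m / \<epsilon>\<^sup>2) \<Longrightarrow> image_norm d m Y (net_point m \<epsilon> k) \<le> b"
    and lower: "\<And>k. k \<in> lattice_ball m (real m / \<epsilon>\<^sup>2) \<Longrightarrow> 1 / 4 \<le> (\<Sum>j<m. (net_point m \<epsilon> k j)\<^sup>2) \<Longrightarrow>
      a \<le> image_norm d m Y (net_point m \<epsilon> k)"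
  shows "(a - 2 * \<epsilon> * b) * L2_set u {..<m} \<le> image_norm d m Y u"
proof (cases "L2_set u {..<m} = 0")
  case True
  then show ?thesis by (simp add: image_norm_nonneg)
next
  case False
  define r where "r = L2_set u {..<m}"
  have r: "r > 0" using False L2_set_nonneg[of u "{..<m}"] by (simp add: r_def less_le)
  define x where "x j = u j / r" for j
  have r2: "r\<^sup>2 = (\<Sum>j<m. (u j)\<^sup>2)" by (simp add: r_def L2_set_def sum_nonneg)
  have x1: "(\<Sum>j<m. (x j)\<^sup>2) = 1"
    using r by (simp add: x_def power_divide sum_divide_distrib[symmetric] r2[symmetric])
  obtain k where k: "k \<in> lattice_ball m (real m / \<epsilon>\<^sup>2)"
    and e: "(\<Sum>j<m. (x j - net_point m \<epsilon> k j)\<^sup>2) \<le> \<epsilon>\<^sup>2"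
    using ex_net_point[of m \<epsilon> x] assms x1 by auto
  define w where "w = net_point m \<epsilon> k"
  define z where "z j = (w j - x j) / \<epsilon>" for j
  have "(\<Sum>j<m. (z j)\<^sup>2) = (\<Sum>j<m. (x j - w j)\<^sup>2) / \<epsilon>\<^sup>2"
    by (simp add: z_def power_divide sum_divide_distrib power2_commute[of "w _"])
  then have z1: "(\<Sum>j<m. (z j)\<^sup>2) \<le> 1" using e assms(2) by (simp add: w_def)
  have "1 / 4 \<le> (\<Sum>j<m. (w j)\<^sup>2)"
  proof -
    have "1 = L2_set (\<lambda>j. w j + (x j - w j)) {..<m}" by (simp add: L2_set_def x1)
    also have "\<dots> \<le> L2_set w {..<m} + L2_set (\<lambda>j. x j - w j) {..<m}"
      by (rule L2_set_triangle_ineq)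
    also have "L2_set (\<lambda>j. x j - w j) {..<m} \<le> \<epsilon>"
      unfolding L2_set_def w_def using e assms(2) by (intro real_le_lsqrt) (auto intro: sum_nonneg)
    finally have "1 / 2 \<le> L2_set w {..<m}" using assms(3) by linarith
    then have "(1 / 2)\<^sup>2 \<le> (L2_set w {..<m})\<^sup>2" by (intro power_mono) auto
    then show ?thesis by (simp add: L2_set_def sum_nonneg power_divide)
  qed
  then have "a \<le> image_norm d m Y w" unfolding w_def by (intro lower k)
  also have "w = (\<lambda>j. x j + \<epsilon> * z j)" using assms(2) by (simp add: z_def)
  also have "image_norm d m Y (\<lambda>j. x j + \<epsilon> * z j) \<le> image_norm d m Y x + image_norm d m Y (\<lambda>j. \<epsilon> * z j)"
    by (rule image_norm_triangle)
  also have "image_norm d m Y (\<lambda>j. \<epsilon> * z j) \<le> \<epsilon> * (2 * b)"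
    unfolding image_norm_scale using assms(2)
    by (simp, intro image_norm_le_net_bound[OF assms(1-3) upper] z1)
  finally have "a - 2 * \<epsilon> * b \<le> image_norm d m Y x" by simp
  then have "(a - 2 * \<epsilon> * b) * r \<le> image_norm d m Y x * r"
    using r by (intro mult_right_mono) auto
  also have "\<dots> = image_norm d m Y u"
    using r image_norm_scale[of d m Y r x] by (simp add: x_def mult.commute)
  finally show ?thesis by (simp add: r_def)
qed

section \<open>Tails of sums of squares of sub-Gaussian variables\<close>

text \<open>The variance proxy \<open>c\<close> is a free number instead of a multiple of the second
  moment. The extended integral includes integrability in the bound and allows exchanging integrals
  and factoring products without side conditions.\<close>

definition subgaussian_proxy :: "'a measure \<Rightarrow> real \<Rightarrow> ('a \<Rightarrow> real) \<Rightarrow> bool" where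
  "subgaussian_proxy M c W \<longleftrightarrow> W \<in> borel_measurable M \<and>
     (\<forall>t. (\<integral>\<^sup>+x. ennreal (exp (t * W x)) \<partial>M) \<le> ennreal (exp (t\<^sup>2 * c / 2)))"

lemma nn_integral_normal_density:
  "\<sigma> > 0 \<Longrightarrow> (\<integral>\<^sup>+x. ennreal (normal_density \<mu> \<sigma> x) \<partial>lborel) = 1"
  by (subst nn_integral_eq_integral) auto

text \<open>Completing the square: tilting the standard normal density by exp (a g) shifts its mean
  to a.\<close>

lemma nn_integral_std_normal_exp:
  "(\<integral>\<^sup>+g. ennreal (std_normal_density g * exp (a * g)) \<partial>lborel) = ennreal (exp (a\<^sup>2 / 2))"
proof -
  have "std_normal_density g * exp (a * g) = exp (a\<^sup>2 / 2) * normal_density a 1 g" for g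
  proof -
    have "exp (- g\<^sup>2 / 2) * exp (a * g) = exp (a\<^sup>2 / 2) * exp (- (g - a)\<^sup>2 / 2)"
      unfolding exp_add[symmetric] by (simp add: power2_eq_square field_simps)
    then show ?thesis by (simp add: normal_density_def)
  qed
  then have "(\<integral>\<^sup>+g. ennreal (std_normal_density g * exp (a * g)) \<partial>lborel)
      = (\<integral>\<^sup>+g. ennreal (exp (a\<^sup>2 / 2)) * ennreal (normal_density a 1 g) \<partial>lborel)"
    by (simp add: ennreal_mult)
  also have "\<dots> = ennreal (exp (a\<^sup>2 / 2))"
    by (subst nn_integral_cmult) (simp_all add: nn_integral_normal_density)
  finally show ?thesis .
qed

text \<open>Tilting by a Gaussian factor only changes the variance, from 1 to 1 / (1 - a).\<close>

lemma nn_integral_std_normal_exp_square: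
  assumes "a < 1"
  shows "(\<integral>\<^sup>+g. ennreal (std_normal_density g * exp (a * g\<^sup>2 / 2)) \<partial>lborel)
    = ennreal (1 / sqrt (1 - a))"
proof -
  define \<sigma> where "\<sigma> = 1 / sqrt (1 - a)"
  have \<sigma>: "\<sigma> > 0" "\<sigma>\<^sup>2 = 1 / (1 - a)"
    using assms by (auto simp: \<sigma>_def power_divide)
  have "std_normal_density g * exp (a * g\<^sup>2 / 2) = \<sigma> * normal_density 0 \<sigma> g" for g
  proof -
    have "exp (- g\<^sup>2 / 2) * exp (a * g\<^sup>2 / 2) = exp (- g\<^sup>2 / (2 * \<sigma>\<^sup>2))"
      unfolding exp_add[symmetric] using assms by (simp add: \<sigma> field_simps)
    moreover have "sqrt (2 * pi * \<sigma>\<^sup>2) = sqrt (2 * pi) * \<sigma>"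
      using \<sigma>(1) by (simp add: real_sqrt_mult)
    ultimately show ?thesis using \<sigma>(1) by (simp add: normal_density_def)
  qed
  then have "(\<integral>\<^sup>+g. ennreal (std_normal_density g * exp (a * g\<^sup>2 / 2)) \<partial>lborel)
      = (\<integral>\<^sup>+g. ennreal \<sigma> * ennreal (normal_density 0 \<sigma> g) \<partial>lborel)"
    using \<sigma>(1) by (simp add: ennreal_mult)
  also have "\<dots> = ennreal \<sigma>"
    using \<sigma>(1) by (subst nn_integral_cmult) (simp_all add: nn_integral_normal_density)
  finally show ?thesis by (simp add: \<sigma>_def)
qed

text \<open>Linearization: \<open>exp (s W\<^sup>2)\<close> is the expectation of \<open>exp (sqrt (2 s) g W)\<close> over a standard
  normal \<open>g\<close>, so that the sub-Gaussian bound applies after exchanging the integrals.\<close>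

lemma subgaussian_proxy_exp_square:
  assumes "sigma_finite_measure M" and W: "subgaussian_proxy M c W" and "0 \<le> s" "2 * s * c < 1"
  shows "(\<integral>\<^sup>+x. ennreal (exp (s * (W x)\<^sup>2)) \<partial>M) \<le> ennreal (1 / sqrt (1 - 2 * s * c))"
proof -
  interpret pair_sigma_finite M lborel
    using assms(1) by (intro pair_sigma_finite.intro sigma_finite_lborel)
  have [measurable]: "W \<in> borel_measurable M"
    and mgf: "\<And>t. (\<integral>\<^sup>+x. ennreal (exp (t * W x)) \<partial>M) \<le> ennreal (exp (t\<^sup>2 * c / 2))"
    using W by (auto simp: subgaussian_proxy_def)
  have "(\<integral>\<^sup>+x. ennreal (exp (s * (W x)\<^sup>2)) \<partial>M)
      = (\<integral>\<^sup>+x. (\<integral>\<^sup>+g. ennreal (std_normal_density g * exp (sqrt (2 * s) * W x * g)) \<partial>lborel) \<partial>M)"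
    using assms(3) by (intro nn_integral_cong, subst nn_integral_std_normal_exp)
      (simp add: power_mult_distrib)
  also have "\<dots> = (\<integral>\<^sup>+g. (\<integral>\<^sup>+x. ennreal (std_normal_density g * exp (sqrt (2 * s) * W x * g)) \<partial>M) \<partial>lborel)"
    by (subst Fubini') simp_all
  also have "\<dots> \<le> (\<integral>\<^sup>+g. ennreal (std_normal_density g * exp (2 * s * c * g\<^sup>2 / 2)) \<partial>lborel)"
  proof (intro nn_integral_mono)
    fix g :: real
    have "(\<integral>\<^sup>+x. ennreal (std_normal_density g * exp (sqrt (2 * s) * W x * g)) \<partial>M)
        = ennreal (std_normal_density g) * (\<integral>\<^sup>+x. ennreal (exp ((sqrt (2 * s) * g) * W x)) \<partial>M)"
      by (subst nn_integral_cmult[symmetric]) (auto simp: ennreal_mult mult_ac)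
    also have "\<dots> \<le> ennreal (std_normal_density g) * ennreal (exp ((sqrt (2 * s) * g)\<^sup>2 * c / 2))"
      by (intro mult_left_mono mgf) simp
    also have "\<dots> = ennreal (std_normal_density g * exp (2 * s * c * g\<^sup>2 / 2))"
      using assms(3) by (simp add: ennreal_mult[symmetric] power_mult_distrib mult_ac)
    finally show "(\<integral>\<^sup>+x. ennreal (std_normal_density g * exp (sqrt (2 * s) * W x * g)) \<partial>M)
        \<le> ennreal (std_normal_density g * exp (2 * s * c * g\<^sup>2 / 2))" .
  qed
  also have "\<dots> = ennreal (1 / sqrt (1 - 2 * s * c))"
    by (rule nn_integral_std_normal_exp_square) (use assms(4) in simp)
  finally show ?thesis .
qed

text \<open>The constant is 4^4, from raising z / 4 \<le> exp (z / 4) to the fourth power.\<close>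

lemma power4_le_exp_add_exp: "(z::real) ^ 4 \<le> 256 * (exp z + exp (- z))"
proof -
  have *: "z ^ 4 \<le> 256 * exp z" if "z \<ge> 0" for z :: real
  proof -
    have "z / 4 \<le> exp (z / 4)" using exp_ge_add_one_self[of "z / 4"] by linarith
    then have "(z / 4) ^ 4 \<le> exp (z / 4) ^ 4" using that by (intro power_mono) auto
    also have "\<dots> = exp z" by (simp add: exp_of_nat_mult[symmetric])
    finally show ?thesis by (simp add: power_divide)
  qed
  show ?thesis
  proof (cases "z \<ge> 0")
    case True
    then show ?thesis using *[of z] exp_ge_zero[of "-z"] by (simp add: add_increasing2 distrib_left)
  next
    case False
    then show ?thesis using *[of "-z"] exp_ge_zero[of z] by (simp add: add_increasing distrib_left)
  qed
qed

lemma subgaussian_proxy_fourth_moment: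
  assumes W: "subgaussian_proxy M c W" and "c > 0"
  shows "(\<integral>\<^sup>+x. ennreal ((W x) ^ 4) \<partial>M) \<le> ennreal (1024 * c\<^sup>2)"
proof -
  have [measurable]: "W \<in> borel_measurable M"
    and mgf: "\<And>t. (\<integral>\<^sup>+x. ennreal (exp (t * W x)) \<partial>M) \<le> ennreal (exp (t\<^sup>2 * c / 2))"
    using W by (auto simp: subgaussian_proxy_def)
  \<comment> \<open>This scale makes both exponential moments at most exp (1/2) \<le> 2, whence 256
    * (2 + 2) = 1024.\<close>
  define t where "t = 1 / sqrt c"
  have t2: "t\<^sup>2 * c = 1" "t ^ 4 * c\<^sup>2 = 1"
    using assms(2) by (simp_all add: t_def power_divide power4_eq_xxxx power2_eq_square field_simps)
  have pw: "(W x) ^ 4 \<le> 256 * c\<^sup>2 * (exp (t * W x) + exp (- t * W x))" for x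
  proof -
    have "c\<^sup>2 * (t * W x) ^ 4 \<le> c\<^sup>2 * (256 * (exp (t * W x) + exp (- (t * W x))))"
      by (intro mult_left_mono power4_le_exp_add_exp) simp
    moreover have "c\<^sup>2 * (t * W x) ^ 4 = (W x) ^ 4"
      using t2(2) by (simp add: power_mult_distrib mult.assoc[symmetric] mult.commute[of "c\<^sup>2"])
    ultimately show ?thesis by (simp add: mult_ac)
  qed
  have "(\<integral>\<^sup>+x. ennreal ((W x) ^ 4) \<partial>M)
      \<le> (\<integral>\<^sup>+x. ennreal (256 * c\<^sup>2) * (ennreal (exp (t * W x)) + ennreal (exp (- t * W x))) \<partial>M)"
    by (intro nn_integral_mono)
      (use pw in \<open>simp add: ennreal_plus[symmetric] ennreal_mult[symmetric] del: ennreal_plus\<close>)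
  also have "\<dots> = ennreal (256 * c\<^sup>2) *
      ((\<integral>\<^sup>+x. ennreal (exp (t * W x)) \<partial>M) + (\<integral>\<^sup>+x. ennreal (exp (- t * W x)) \<partial>M))"
    by (subst nn_integral_cmult, measurable, subst nn_integral_add) auto
  also have "\<dots> \<le> ennreal (256 * c\<^sup>2) * (ennreal (exp (1 / 2)) + ennreal (exp (1 / 2)))"
    using mgf[of t] mgf[of "- t"] t2(1) by (intro mult_left_mono add_mono) auto
  also have "\<dots> = ennreal (256 * c\<^sup>2 * (exp (1 / 2) + exp (1 / 2)))"
    by (simp add: ennreal_plus[symmetric] ennreal_mult[symmetric] del: ennreal_plus)
  also have "\<dots> \<le> ennreal (1024 * c\<^sup>2)"
  proof (intro ennreal_leI)
    have "exp (1 / 2 :: real) \<le> 2" using exp_half_le2 by simp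
    then have "256 * c\<^sup>2 * (exp (1 / 2) + exp (1 / 2)) \<le> 256 * c\<^sup>2 * (2 + 2)"
      by (intro mult_left_mono) auto
    then show "256 * c\<^sup>2 * (exp (1 / 2) + exp (1 / 2)) \<le> 1024 * c\<^sup>2" by simp
  qed
  finally show ?thesis .
qed

lemma exp_minus_le_quadratic:
  fixes x :: real
  assumes "x \<ge> 0"
  shows "exp (- x) \<le> 1 - x + x\<^sup>2 / 2"
proof -
  define f where "f x = 1 - x + x\<^sup>2 / 2 - exp (- x)" for x :: real
  have "f 0 \<le> f x"
  proof (rule DERIV_nonneg_imp_nondecreasing[OF assms])
    fix y :: real
    have "(f has_real_derivative y - 1 + exp (- y)) (at y)"
      unfolding f_def by (auto intro!: derivative_eq_intros)
    moreover have "y - 1 + exp (- y) \<ge> 0" using exp_ge_add_one_self[of "- y"] by linarith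
    ultimately show "\<exists>z. (f has_real_derivative z) (at y) \<and> 0 \<le> z" by blast
  qed
  then show ?thesis by (simp add: f_def)
qed

text \<open>Expanding exp (- s W^2) to second order, the error is s^2 / 2 times the fourth moment.
  The proxy is proportional to the variance \<Lambda>, so this error is of order \<Lambda>^2; 512 is
  half of 1024.\<close>

lemma (in prob_space) subgaussian_proxy_exp_neg_square:
  assumes W: "subgaussian_proxy M (K * \<Lambda>) W"
    and int: "integrable M (\<lambda>x. (W x)\<^sup>2)" and \<Lambda>: "expectation (\<lambda>x. (W x)\<^sup>2) = \<Lambda>"
    and "K > 0" "0 \<le> s"
  shows "(\<integral>\<^sup>+x. ennreal (exp (- s * (W x)\<^sup>2)) \<partial>M) \<le> ennreal (exp (- s * \<Lambda> + 512 * s\<^sup>2 * K\<^sup>2 * \<Lambda>\<^sup>2))"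
proof (cases "\<Lambda> = 0")
  \<comment> \<open>The fourth moment bound needs a positive proxy; for \<Lambda> = 0 the claimed
    bound is 1.\<close>
  case True
  have "(\<integral>\<^sup>+x. ennreal (exp (- s * (W x)\<^sup>2)) \<partial>M) \<le> (\<integral>\<^sup>+x. 1 \<partial>M)"
    using assms(5) by (intro nn_integral_mono) (auto simp: ennreal_le_1)
  then show ?thesis using True by (simp add: emeasure_space_1)
next
  case False
  have [measurable]: "W \<in> borel_measurable M"
    using W by (auto simp: subgaussian_proxy_def)
  have "\<Lambda> \<ge> 0" unfolding \<Lambda>[symmetric] by (intro integral_nonneg_AE) auto
  then have pos: "K * \<Lambda> > 0" using False assms(4) by auto
  note m4 = subgaussian_proxy_fourth_moment[OF W pos]
  have int4: "integrable M (\<lambda>x. (W x) ^ 4)"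
    using m4 by (intro integrableI_bounded) (auto simp: top.extremum_strict intro: le_less_trans)
  have "ennreal (expectation (\<lambda>x. (W x) ^ 4)) \<le> ennreal (1024 * (K * \<Lambda>)\<^sup>2)"
    using m4 by (subst (asm) nn_integral_eq_integral[OF int4]) auto
  then have m4': "expectation (\<lambda>x. (W x) ^ 4) \<le> 1024 * (K * \<Lambda>)\<^sup>2"
    by (subst (asm) ennreal_le_iff) auto
  have intB: "integrable M (\<lambda>x. 1 - s * (W x)\<^sup>2 + s\<^sup>2 / 2 * (W x) ^ 4)"
    using int int4 by auto
  have pw: "exp (- s * (W x)\<^sup>2) \<le> 1 - s * (W x)\<^sup>2 + s\<^sup>2 / 2 * (W x) ^ 4" for x
    using exp_minus_le_quadratic[of "s * (W x)\<^sup>2"] assms(5)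
    by (simp add: power_mult_distrib power4_eq_xxxx power2_eq_square mult_ac)
  have "(\<integral>\<^sup>+x. ennreal (exp (- s * (W x)\<^sup>2)) \<partial>M)
      \<le> (\<integral>\<^sup>+x. ennreal (1 - s * (W x)\<^sup>2 + s\<^sup>2 / 2 * (W x) ^ 4) \<partial>M)"
    by (intro nn_integral_mono ennreal_leI pw)
  also have "\<dots> = ennreal (expectation (\<lambda>x. 1 - s * (W x)\<^sup>2 + s\<^sup>2 / 2 * (W x) ^ 4))"
    using order_trans[OF exp_ge_zero pw] by (intro nn_integral_eq_integral intB) auto
  also have "expectation (\<lambda>x. 1 - s * (W x)\<^sup>2 + s\<^sup>2 / 2 * (W x) ^ 4)
      = 1 - s * \<Lambda> + s\<^sup>2 / 2 * expectation (\<lambda>x. (W x) ^ 4)"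
    using int int4 by (simp add: prob_space \<Lambda>)
  also have "ennreal \<dots> \<le> ennreal (exp (- s * \<Lambda> + 512 * s\<^sup>2 * K\<^sup>2 * \<Lambda>\<^sup>2))"
  proof (intro ennreal_leI)
    have "s\<^sup>2 / 2 * expectation (\<lambda>x. (W x) ^ 4) \<le> s\<^sup>2 / 2 * (1024 * (K * \<Lambda>)\<^sup>2)"
      by (intro mult_left_mono m4') auto
    also have "\<dots> = 512 * s\<^sup>2 * K\<^sup>2 * \<Lambda>\<^sup>2" by (simp add: power_mult_distrib)
    finally have "1 - s * \<Lambda> + s\<^sup>2 / 2 * expectation (\<lambda>x. (W x) ^ 4)
      \<le> 1 + (- s * \<Lambda> + 512 * s\<^sup>2 * K\<^sup>2 * \<Lambda>\<^sup>2)" by simp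
    also have "\<dots> \<le> exp (- s * \<Lambda> + 512 * s\<^sup>2 * K\<^sup>2 * \<Lambda>\<^sup>2)" by (rule exp_ge_add_one_self)
    finally show "1 - s * \<Lambda> + s\<^sup>2 / 2 * expectation (\<lambda>x. (W x) ^ 4)
      \<le> exp (- s * \<Lambda> + 512 * s\<^sup>2 * K\<^sup>2 * \<Lambda>\<^sup>2)" .
  qed
  finally show ?thesis .
qed

text \<open>Turns the factor from the Gaussian integral into an exponential linear in the variance,
  so that the factors of independent variables combine into the total variance.\<close>

lemma inverse_sqrt_one_minus_half_le:
  fixes x :: real
  assumes "0 \<le> x" "x \<le> 1"
  shows "1 / sqrt (1 - x / 2) \<le> exp (x / 2)"
proof -
  have "exp (- x) \<le> 1 - x / 2"
  proof -
    have "x\<^sup>2 \<le> x" using assms by (simp add: power2_eq_square mult_left_le)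
    then show ?thesis using exp_minus_le_quadratic[OF assms(1)] by linarith
  qed
  then have "sqrt (exp (- x)) \<le> sqrt (1 - x / 2)" by simp
  moreover have "sqrt (exp (- x)) = exp (- x / 2)"
    by (intro real_sqrt_unique) (auto simp: power2_eq_square exp_add[symmetric])
  ultimately have "1 / sqrt (1 - x / 2) \<le> 1 / exp (- x / 2)"
    using assms by (intro divide_left_mono) auto
  then show ?thesis by (simp add: exp_minus inverse_eq_divide)
qed

section \<open>Chernoff bounds for sums of squares\<close>

lemma (in prob_space) Chernoff_bound:
  assumes [measurable]: "Q \<in> borel_measurable M"
    and le: "(\<integral>\<^sup>+x. ennreal (exp (Q x)) \<partial>M) \<le> ennreal b" and "b \<ge> 0"
  shows "prob {x \<in> space M. a \<le> Q x} \<le> b / exp a"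
proof -
  have "{x \<in> space M. a \<le> Q x} = {x \<in> space M. 1 \<le> ennreal (exp (- a)) * ennreal (exp (Q x))}"
    by (auto simp: ennreal_mult[symmetric] exp_add[symmetric])
  then have "emeasure M {x \<in> space M. a \<le> Q x}
      \<le> ennreal (exp (- a)) * (\<integral>\<^sup>+x. ennreal (exp (Q x)) * indicator (space M) x \<partial>M)"
    using nn_integral_Markov_inequality[of "\<lambda>x. ennreal (exp (Q x))" "space M" M "ennreal (exp (- a))"]
    by simp
  also have "(\<integral>\<^sup>+x. ennreal (exp (Q x)) * indicator (space M) x \<partial>M) = (\<integral>\<^sup>+x. ennreal (exp (Q x)) \<partial>M)"
    by (intro nn_integral_cong) auto
  also have "ennreal (exp (- a)) * \<dots> \<le> ennreal (exp (- a)) * ennreal b"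
    by (intro mult_left_mono le) simp
  also have "\<dots> = ennreal (b / exp a)"
    using assms(3) by (simp add: ennreal_mult[symmetric] exp_minus field_simps)
  finally show ?thesis using assms(3) by (simp add: emeasure_eq_measure)
qed

lemma (in prob_space) nn_integral_exp_sum_indep:
  assumes "finite I" and ind: "indep_vars (\<lambda>_. borel) W I"
    and f: "f \<in> borel_measurable borel"
    and le: "\<And>i. i \<in> I \<Longrightarrow> (\<integral>\<^sup>+x. ennreal (exp (f (W i x))) \<partial>M) \<le> ennreal (exp (b i))"
  shows "(\<integral>\<^sup>+x. ennreal (exp (\<Sum>i\<in>I. f (W i x))) \<partial>M) \<le> ennreal (exp (\<Sum>i\<in>I. b i))"
proof -
  note [measurable] = f
  have "indep_vars (\<lambda>_. borel) (\<lambda>i x. ennreal (exp (f (W i x)))) I"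
    by (rule indep_vars_compose2[OF ind]) simp
  then have "(\<integral>\<^sup>+x. (\<Prod>i\<in>I. ennreal (exp (f (W i x)))) \<partial>M)
      = (\<Prod>i\<in>I. \<integral>\<^sup>+x. ennreal (exp (f (W i x))) \<partial>M)"
    using assms(1) by (intro indep_vars_nn_integral) auto
  also have "\<dots> \<le> (\<Prod>i\<in>I. ennreal (exp (b i)))"
    by (intro prod_mono_ennreal le)
  finally show ?thesis using assms(1) by (simp add: prod_ennreal exp_sum)
qed

text \<open>One s must satisfy 2 * s * K * \<Lambda> i < 1 for all i, which is where \<Lambda> i
  \<le> 1 helps; s = 1 / (4 K) makes this quantity \<Lambda> i / 2. \<open>T\<close> is only an
  upper bound for the total variance, so that vectors of different norms share one
  threshold.\<close>

lemma (in prob_space) sum_squares_upper_tail: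
  assumes "finite I" and ind: "indep_vars (\<lambda>_. borel) W I" and "K > 0"
    and W: "\<And>i. i \<in> I \<Longrightarrow> subgaussian_proxy M (K * \<Lambda> i) (W i)"
    and \<Lambda>: "\<And>i. i \<in> I \<Longrightarrow> 0 \<le> \<Lambda> i \<and> \<Lambda> i \<le> 1"
    and T: "(\<Sum>i\<in>I. \<Lambda> i) \<le> T"
  shows "prob {x \<in> space M. 4 * K * T \<le> (\<Sum>i\<in>I. (W i x)\<^sup>2)} \<le> exp (- T / 2)"
proof -
  have [measurable]: "W i \<in> borel_measurable M" if "i \<in> I" for i
    using W[OF that] by (simp add: subgaussian_proxy_def)
  define s where "s = 1 / (4 * K)"
  have s: "s > 0" "s * K = 1 / 4" using assms(3) by (auto simp: s_def)
  have "(\<integral>\<^sup>+x. ennreal (exp (s * (W i x)\<^sup>2)) \<partial>M) \<le> ennreal (exp (\<Lambda> i / 2))" if "i \<in> I" for i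
  proof -
    have eq: "2 * s * (K * \<Lambda> i) = \<Lambda> i / 2" using s(2) by simp
    then have "2 * s * (K * \<Lambda> i) < 1" using \<Lambda>[OF that] by linarith
    then have "(\<integral>\<^sup>+x. ennreal (exp (s * (W i x)\<^sup>2)) \<partial>M) \<le> ennreal (1 / sqrt (1 - 2 * s * (K * \<Lambda> i)))"
      using s by (intro subgaussian_proxy_exp_square W[OF that] sigma_finite_measure_axioms) auto
    also have "\<dots> \<le> ennreal (exp (\<Lambda> i / 2))"
      unfolding eq by (intro ennreal_leI inverse_sqrt_one_minus_half_le) (use \<Lambda>[OF that] in auto)
    finally show ?thesis .
  qed
  then have "(\<integral>\<^sup>+x. ennreal (exp (\<Sum>i\<in>I. s * (W i x)\<^sup>2)) \<partial>M) \<le> ennreal (exp (\<Sum>i\<in>I. \<Lambda> i / 2))"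
    by (intro nn_integral_exp_sum_indep[OF assms(1) ind]) auto
  also have "\<dots> \<le> ennreal (exp (T / 2))"
    using T by (intro ennreal_leI) (simp add: sum_divide_distrib[symmetric])
  finally have "prob {x \<in> space M. T \<le> (\<Sum>i\<in>I. s * (W i x)\<^sup>2)} \<le> exp (T / 2) / exp T"
    by (intro Chernoff_bound) auto
  moreover have "{x \<in> space M. T \<le> (\<Sum>i\<in>I. s * (W i x)\<^sup>2)}
      = {x \<in> space M. 4 * K * T \<le> (\<Sum>i\<in>I. (W i x)\<^sup>2)}"
  proof -
    have "(\<Sum>i\<in>I. s * (W i x)\<^sup>2) = (\<Sum>i\<in>I. (W i x)\<^sup>2) / (4 * K)" for x
      by (simp add: s_def sum_divide_distrib)
    then show ?thesis using assms(3) by (simp add: pos_le_divide_eq mult_ac)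
  qed
  ultimately show ?thesis by (simp add: exp_diff[symmetric])
qed

text \<open>The exponential moment is at most exp (- s T / 8), and the threshold T / 16 costs a
  factor exp (s T / 16). The factor 1/4 in the hypothesis on \<open>T\<close> allows for vectors of
  norm as small as 1/2.\<close>

lemma (in prob_space) sum_squares_lower_tail:
  assumes "finite I" and ind: "indep_vars (\<lambda>_. borel) W I" and "K > 0"
    and W: "\<And>i. i \<in> I \<Longrightarrow> subgaussian_proxy M (K * \<Lambda> i) (W i)"
    and int: "\<And>i. i \<in> I \<Longrightarrow> integrable M (\<lambda>x. (W i x)\<^sup>2)"
    and E: "\<And>i. i \<in> I \<Longrightarrow> expectation (\<lambda>x. (W i x)\<^sup>2) = \<Lambda> i"
    and \<Lambda>: "\<And>i. i \<in> I \<Longrightarrow> 0 \<le> \<Lambda> i \<and> \<Lambda> i \<le> 1"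
    and T: "T / 4 \<le> (\<Sum>i\<in>I. \<Lambda> i)"
  shows "prob {x \<in> space M. (\<Sum>i\<in>I. (W i x)\<^sup>2) \<le> T / 16} \<le> exp (- T / (16384 * K\<^sup>2))"
proof -
  have [measurable]: "W i \<in> borel_measurable M" if "i \<in> I" for i
    using W[OF that] by (simp add: subgaussian_proxy_def)
  \<comment> \<open>Chosen so that the second-order error is s / 2 * (\<Lambda> i)^2, which is at
    most half of the main term s * \<Lambda> i because \<Lambda> i \<le> 1.\<close>
  define s where "s = 1 / (1024 * K\<^sup>2)"
  have s: "s > 0" "s * K\<^sup>2 = 1 / 1024" using assms(3) by (auto simp: s_def)
  have "(\<integral>\<^sup>+x. ennreal (exp (- s * (W i x)\<^sup>2)) \<partial>M) \<le> ennreal (exp (- s * \<Lambda> i / 2))" if "i \<in> I" for i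
  proof -
    have "(\<integral>\<^sup>+x. ennreal (exp (- s * (W i x)\<^sup>2)) \<partial>M)
        \<le> ennreal (exp (- s * \<Lambda> i + 512 * s\<^sup>2 * K\<^sup>2 * (\<Lambda> i)\<^sup>2))"
      using s by (intro subgaussian_proxy_exp_neg_square W int E that assms(3)) auto
    also have "\<dots> \<le> ennreal (exp (- s * \<Lambda> i / 2))"
    proof (intro ennreal_leI)
      have "512 * s\<^sup>2 * K\<^sup>2 * (\<Lambda> i)\<^sup>2 = 512 * (s * K\<^sup>2) * s * (\<Lambda> i)\<^sup>2"
        by (simp add: power2_eq_square)
      also have "\<dots> = s / 2 * (\<Lambda> i)\<^sup>2" by (simp add: s(2))
      also have "\<dots> \<le> s / 2 * \<Lambda> i"
        using s \<Lambda>[OF that] by (intro mult_left_mono) (auto simp: power2_eq_square mult_left_le)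
      finally show "exp (- s * \<Lambda> i + 512 * s\<^sup>2 * K\<^sup>2 * (\<Lambda> i)\<^sup>2) \<le> exp (- s * \<Lambda> i / 2)" by simp
    qed
    finally show ?thesis .
  qed
  then have "(\<integral>\<^sup>+x. ennreal (exp (\<Sum>i\<in>I. - s * (W i x)\<^sup>2)) \<partial>M) \<le> ennreal (exp (\<Sum>i\<in>I. - s * \<Lambda> i / 2))"
    by (intro nn_integral_exp_sum_indep[OF assms(1) ind]) auto
  also have "\<dots> \<le> ennreal (exp (- s * T / 8))"
  proof (intro ennreal_leI)
    have "(\<Sum>i\<in>I. - s * \<Lambda> i / 2) = - s / 2 * (\<Sum>i\<in>I. \<Lambda> i)"
      by (simp add: sum_distrib_left sum_negf)
    moreover have "s / 2 * (T / 4) \<le> s / 2 * (\<Sum>i\<in>I. \<Lambda> i)"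
      using s T by (intro mult_left_mono) auto
    ultimately show "exp (\<Sum>i\<in>I. - s * \<Lambda> i / 2) \<le> exp (- s * T / 8)" by simp
  qed
  finally have "prob {x \<in> space M. - s * T / 16 \<le> (\<Sum>i\<in>I. - s * (W i x)\<^sup>2)}
      \<le> exp (- s * T / 8) / exp (- s * T / 16)"
    by (intro Chernoff_bound) auto
  also have "\<dots> = exp (- T / (16384 * K\<^sup>2))"
    unfolding exp_diff[symmetric] by (simp add: s_def)
  also have "{x \<in> space M. - s * T / 16 \<le> (\<Sum>i\<in>I. - s * (W i x)\<^sup>2)}
      = {x \<in> space M. (\<Sum>i\<in>I. (W i x)\<^sup>2) \<le> T / 16}"
  proof -
    have "- s * T / 16 \<le> (\<Sum>i\<in>I. - s * (W i x)\<^sup>2) \<longleftrightarrow> s * (\<Sum>i\<in>I. (W i x)\<^sup>2) \<le> s * (T / 16)" for x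
      by (simp add: sum_distrib_left sum_negf)
    then show ?thesis using s(1) by simp
  qed
  finally show ?thesis .
qed

section \<open>Linear combinations of sample points\<close>

text \<open>Independence has two sources: across sample points from the product measure, across
  coordinates from \<open>D\<close>. An intersection of events over all pairs is a box whose j-th
  side \<open>B j\<close> collects the conditions on sample point j.\<close>

lemma indep_vars_product_sample:
  fixes Z :: "nat \<Rightarrow> 'a \<Rightarrow> real"
  assumes "prob_space D" and ind: "prob_space.indep_vars D (\<lambda>_. borel) Z {..<d}"
  shows "prob_space.indep_vars (PiM {..<m} (\<lambda>_. D)) (\<lambda>_. borel)
    (\<lambda>p S. Z (fst p) (S (snd p))) ({..<d::nat} \<times> {..<m::nat})"
proof -
  interpret D: prob_space D by fact
  interpret P: finite_product_prob_space "\<lambda>_. D" "{..<m}" by unfold_locales auto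
  let ?P = "PiM {..<m} (\<lambda>_. D)"
  let ?I = "{..<d} \<times> {..<m}"
  have Z[measurable]: "Z i \<in> borel_measurable D" if "i < d" for i
    using ind that by (auto simp: D.indep_vars_def)
  have rv: "(\<lambda>S. Z i (S j)) \<in> borel_measurable ?P" if "i < d" "j < m" for i j
    using that by (intro measurable_compose[OF measurable_component_singleton[of j "{..<m}" "\<lambda>_. D"] Z]) auto
  have marginal: "P.prob ((\<lambda>S. Z i (S j)) -` A \<inter> space ?P) = D.prob (Z i -` A \<inter> space D)"
    if "i < d" "j < m" "A \<in> sets borel" for i j and A :: "real set"
  proof -
    have B: "Z i -` A \<inter> space D \<in> sets D" using that by measurable
    have "D.prob (Z i -` A \<inter> space D) = measure (distr ?P D (\<lambda>S. S j)) (Z i -` A \<inter> space D)"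
      using P.PiM_component[of j] that by simp
    also have "\<dots> = P.prob ((\<lambda>S. S j) -` (Z i -` A \<inter> space D) \<inter> space ?P)"
      using that B by (intro measure_distr) auto
    also have "(\<lambda>S. S j) -` (Z i -` A \<inter> space D) \<inter> space ?P = (\<lambda>S. Z i (S j)) -` A \<inter> space ?P"
      using that by (auto simp: space_PiM)
    finally show ?thesis by simp
  qed
  show ?thesis
  proof (cases "?I = {}")
    \<comment> \<open>Treated apart because an intersection over no indices is \<open>UNIV\<close>,
      not the sample space.\<close>
    case True
    then show ?thesis by (auto simp: P.indep_vars_def P.indep_sets_def)
  next
    case False
    then have d: "d > 0" and m: "m > 0" by auto
    show ?thesis
    proof (subst P.indep_vars_finite[where E = "\<lambda>_. sets borel"])
      show "\<forall>A\<in>?I \<rightarrow> sets borel.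
        P.prob (\<Inter>p\<in>?I. (\<lambda>S. Z (fst p) (S (snd p))) -` A p \<inter> space ?P) =
        (\<Prod>p\<in>?I. P.prob ((\<lambda>S. Z (fst p) (S (snd p))) -` A p \<inter> space ?P))"
      proof
        fix A :: "nat \<times> nat \<Rightarrow> real set" assume A: "A \<in> ?I \<rightarrow> sets borel"
        define B where "B j = (\<Inter>i\<in>{..<d}. Z i -` A (i, j) \<inter> space D)" for j
        have AB: "A (i, j) \<in> sets borel" if "i < d" "j < m" for i j
          using A that by auto
        have B: "B j \<in> sets D" if "j < m" for j
          unfolding B_def using d AB that by (intro sets.finite_INT) auto
        have "(\<Inter>p\<in>?I. (\<lambda>S. Z (fst p) (S (snd p))) -` A p \<inter> space ?P) = PiE {..<m} B"
        proof (rule Set.set_eqI)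
          fix S
          have "S \<in> (\<Inter>p\<in>?I. (\<lambda>S. Z (fst p) (S (snd p))) -` A p \<inter> space ?P)
              \<longleftrightarrow> S \<in> space ?P \<and> (\<forall>i<d. \<forall>j<m. Z i (S j) \<in> A (i, j))"
            using d m by auto
          also have "\<dots> \<longleftrightarrow> S \<in> PiE {..<m} B"
            using d by (auto simp: B_def space_PiM PiE_iff)
          finally show "S \<in> (\<Inter>p\<in>?I. (\<lambda>S. Z (fst p) (S (snd p))) -` A p \<inter> space ?P)
              \<longleftrightarrow> S \<in> PiE {..<m} B" .
        qed
        then have "P.prob (\<Inter>p\<in>?I. (\<lambda>S. Z (fst p) (S (snd p))) -` A p \<inter> space ?P)
            = (\<Prod>j<m. D.prob (B j))"
          using P.finite_measure_PiM_emb[of B] B by simp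
        also have "\<dots> = (\<Prod>j<m. \<Prod>i<d. D.prob (Z i -` A (i, j) \<inter> space D))"
          unfolding B_def using d AB by (intro prod.cong refl D.indep_varsD[OF ind]) auto
        also have "\<dots> = (\<Prod>i<d. \<Prod>j<m. D.prob (Z i -` A (i, j) \<inter> space D))"
          by (rule prod.swap)
        also have "\<dots> = (\<Prod>i<d. \<Prod>j<m. P.prob ((\<lambda>S. Z i (S j)) -` A (i, j) \<inter> space ?P))"
          by (intro prod.cong refl) (simp add: marginal AB)
        also have "\<dots> = (\<Prod>p\<in>?I. P.prob ((\<lambda>S. Z (fst p) (S (snd p))) -` A p \<inter> space ?P))"
          by (simp add: prod.cartesian_product split_def)
        finally show "P.prob (\<Inter>p\<in>?I. (\<lambda>S. Z (fst p) (S (snd p))) -` A p \<inter> space ?P) =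
          (\<Prod>p\<in>?I. P.prob ((\<lambda>S. Z (fst p) (S (snd p))) -` A p \<inter> space ?P))" .
      qed
    qed (use False rv in \<open>auto simp: sets.Int_stable sets.sigma_sets_eq[of borel, simplified]\<close>)
  qed
qed

text \<open>The i-th combination depends only on the block of pairs with first component i, and
  disjoint blocks of an independent family are independent.\<close>

lemma indep_vars_sample_combination:
  fixes v :: "nat \<Rightarrow> real"
  fixes Z :: "nat \<Rightarrow> 'a \<Rightarrow> real"
  assumes "prob_space D" and ind: "prob_space.indep_vars D (\<lambda>_. borel) Z {..<d}"
  shows "prob_space.indep_vars (PiM {..<m} (\<lambda>_. D)) (\<lambda>_. borel)
    (\<lambda>i S. \<Sum>j<m. v j * Z i (S j)) {..<d::nat}"
proof -
  interpret D: prob_space D by fact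
  interpret P: finite_product_prob_space "\<lambda>_. D" "{..<m}" by unfold_locales auto
  have "P.indep_vars (\<lambda>i. PiM ({i} \<times> {..<m}) (\<lambda>_. borel))
      (\<lambda>i S. restrict (\<lambda>p. Z (fst p) (S (snd p))) ({i} \<times> {..<m})) {..<d}"
    by (rule P.indep_vars_restrict[OF indep_vars_product_sample[OF assms]])
      (auto simp: disjoint_family_on_def)
  then have "P.indep_vars (\<lambda>_. borel)
      (\<lambda>i S. (\<lambda>\<omega>. \<Sum>j<m. v j * \<omega> (i, j)) (restrict (\<lambda>p. Z (fst p) (S (snd p))) ({i} \<times> {..<m}))) {..<d}"
    by (rule P.indep_vars_compose2) measurable
  moreover have "(\<Sum>j<m. v j * restrict (\<lambda>p. Z (fst p) (S (snd p))) ({i} \<times> {..<m}) (i, j))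
      = (\<Sum>j<m. v j * Z i (S j))" for i S
    by (intro sum.cong) auto
  ultimately show ?thesis by (simp only:)
qed

text \<open>The exponential moment factors over the sample points, so the proxies (v j)^2 * c add
  up.\<close>

lemma subgaussian_proxy_sample_combination:
  fixes v :: "nat \<Rightarrow> real"
  assumes "prob_space D" and Z: "subgaussian_proxy D c Z"
  shows "subgaussian_proxy (PiM {..<m} (\<lambda>_. D)) ((\<Sum>j<m. (v j)\<^sup>2) * c) (\<lambda>S. \<Sum>j<m. v j * Z (S j))"
  unfolding subgaussian_proxy_def
proof (intro conjI allI)
  interpret D: prob_space D by fact
  interpret P: finite_product_prob_space "\<lambda>_. D" "{..<m}" by unfold_locales auto
  have [measurable]: "Z \<in> borel_measurable D"
    and mgf: "\<And>t. (\<integral>\<^sup>+x. ennreal (exp (t * Z x)) \<partial>D) \<le> ennreal (exp (t\<^sup>2 * c / 2))"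
    using Z by (auto simp: subgaussian_proxy_def)
  show "(\<lambda>S. \<Sum>j<m. v j * Z (S j)) \<in> borel_measurable (PiM {..<m} (\<lambda>_. D))"
    by measurable
  fix t :: real
  have "(\<integral>\<^sup>+S. ennreal (exp (t * (\<Sum>j<m. v j * Z (S j)))) \<partial>PiM {..<m} (\<lambda>_. D))
      = (\<integral>\<^sup>+S. (\<Prod>j<m. ennreal (exp (t * v j * Z (S j)))) \<partial>PiM {..<m} (\<lambda>_. D))"
    by (intro nn_integral_cong) (simp add: prod_ennreal exp_sum sum_distrib_left mult.assoc)
  also have "\<dots> = (\<Prod>j<m. \<integral>\<^sup>+x. ennreal (exp (t * v j * Z x)) \<partial>D)"
    by (rule P.product_nn_integral_prod) auto
  also have "\<dots> \<le> (\<Prod>j<m. ennreal (exp ((t * v j)\<^sup>2 * c / 2)))"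
    by (intro prod_mono_ennreal mgf)
  also have "\<dots> = ennreal (exp (\<Sum>j<m. (t * v j)\<^sup>2 * c / 2))"
    by (simp add: prod_ennreal exp_sum)
  also have "(\<Sum>j<m. (t * v j)\<^sup>2 * c / 2) = t\<^sup>2 * ((\<Sum>j<m. (v j)\<^sup>2) * c) / 2"
    by (simp add: sum_distrib_left sum_distrib_right sum_divide_distrib power_mult_distrib mult_ac)
  finally show "(\<integral>\<^sup>+S. ennreal (exp (t * (\<Sum>j<m. v j * Z (S j)))) \<partial>PiM {..<m} (\<lambda>_. D))
      \<le> ennreal (exp (t\<^sup>2 * ((\<Sum>j<m. (v j)\<^sup>2) * c) / 2))" .
qed

lemma second_moment_sample_combination:
  fixes v :: "nat \<Rightarrow> real" and Z :: "'a \<Rightarrow> real" and m :: nat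
  assumes "prob_space D" and [measurable]: "Z \<in> borel_measurable D"
    and int: "integrable D Z" "integrable D (\<lambda>x. (Z x)\<^sup>2)"
    and mean: "(\<integral>x. Z x \<partial>D) = 0"
  defines "P \<equiv> PiM {..<m::nat} (\<lambda>_. D)"
  shows "integrable P (\<lambda>S. (\<Sum>j<m. v j * Z (S j))\<^sup>2)"
    and "(\<integral>S. (\<Sum>j<m. v j * Z (S j))\<^sup>2 \<partial>P) = (\<Sum>j<m. (v j)\<^sup>2) * (\<integral>x. (Z x)\<^sup>2 \<partial>D)"
proof -
  interpret D: prob_space D by fact
  interpret P: finite_product_prob_space "\<lambda>_. D" "{..<m}" by unfold_locales auto
  have prod: "integrable P (\<lambda>S. Z (S j) * Z (S l)) \<and>
    (\<integral>S. Z (S j) * Z (S l) \<partial>P) = (if j = l then \<integral>x. (Z x)\<^sup>2 \<partial>D else 0)"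
    if jl: "j < m" "l < m" for j l
  proof -
    \<comment> \<open>Factors whose product over all coordinates is Z (S j) * Z (S l); for j = l the
      two conditions coincide and yield the square.\<close>
    define f where "f k x = (if k = j then Z x else 1) * (if k = l then Z x else 1)" for k x
    have intf: "integrable D (f k)" for k
      unfolding f_def using int by (cases "k = j"; cases "k = l") (auto simp: power2_eq_square)
    have pf: "(\<Prod>k<m. f k (S k)) = Z (S j) * Z (S l)" for S
      unfolding f_def prod.distrib using jl by (simp add: prod.delta)
    have "integrable P (\<lambda>S. \<Prod>k<m. f k (S k))"
      unfolding P_def by (rule P.product_integrable_prod) (auto intro: intf)
    moreover have "(\<integral>S. (\<Prod>k<m. f k (S k)) \<partial>P) = (\<Prod>k<m. \<integral>x. f k x \<partial>D)"
      unfolding P_def by (rule P.product_integral_prod) (auto intro: intf)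
    moreover have "(\<Prod>k<m. \<integral>x. f k x \<partial>D) = (if j = l then \<integral>x. (Z x)\<^sup>2 \<partial>D else 0)"
    proof (cases "j = l")
      case True
      have "(\<integral>x. f k x \<partial>D) = (if k = j then \<integral>x. (Z x)\<^sup>2 \<partial>D else 1)" for k
        using True by (auto simp: f_def power2_eq_square D.prob_space)
      then show ?thesis using True jl by (simp add: prod.delta)
    next
      case False
      then have "(\<integral>x. f j x \<partial>D) = 0" using mean by (simp add: f_def)
      then show ?thesis using False jl by (auto intro!: prod_zero)
    qed
    ultimately show ?thesis by (simp add: pf)
  qed
  have sq: "(\<Sum>j<m. v j * Z (S j))\<^sup>2 = (\<Sum>j<m. \<Sum>l<m. v j * v l * (Z (S j) * Z (S l)))" for S
    by (simp add: power2_eq_square sum_product mult_ac)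
  show "integrable P (\<lambda>S. (\<Sum>j<m. v j * Z (S j))\<^sup>2)"
    unfolding sq using prod by (intro Bochner_Integration.integrable_sum integrable_mult_right) auto
  have "(\<integral>S. (\<Sum>j<m. v j * Z (S j))\<^sup>2 \<partial>P)
      = (\<Sum>j<m. \<integral>S. (\<Sum>l<m. v j * v l * (Z (S j) * Z (S l))) \<partial>P)"
    unfolding sq using prod
    by (intro Bochner_Integration.integral_sum Bochner_Integration.integrable_sum integrable_mult_right) auto
  also have "\<dots> = (\<Sum>j<m. \<Sum>l<m. \<integral>S. v j * v l * (Z (S j) * Z (S l)) \<partial>P)"
    using prod
    by (intro sum.cong refl Bochner_Integration.integral_sum integrable_mult_right) auto
  also have "\<dots> = (\<Sum>j<m. \<Sum>l<m. v j * v l * (\<integral>S. Z (S j) * Z (S l) \<partial>P))"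
    by simp
  also have "\<dots> = (\<Sum>j<m. \<Sum>l<m. if l = j then (v j)\<^sup>2 * (\<integral>x. (Z x)\<^sup>2 \<partial>D) else 0)"
    using prod by (intro sum.cong refl) (auto simp: power2_eq_square)
  finally show "(\<integral>S. (\<Sum>j<m. v j * Z (S j))\<^sup>2 \<partial>P) = (\<Sum>j<m. (v j)\<^sup>2) * (\<integral>x. (Z x)\<^sup>2 \<partial>D)"
    by (simp add: sum_distrib_right)
qed

section \<open>Samples from a sub-Gaussian product distribution\<close>

lemma subgaussian_rel_imp_proxy:
  "subgaussian_rel M \<rho> Z \<Longrightarrow> subgaussian_proxy M (\<rho>\<^sup>2 * (\<integral>x. (Z x)\<^sup>2 \<partial>M)) Z"
  unfolding subgaussian_rel_def subgaussian_proxy_def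
  by (simp add: nn_integral_eq_integral ennreal_leI mult.assoc)

text \<open>Comparing \<open>1 + t * E Z \<le> E (exp (t Z)) \<le> 1 + O(t\<^sup>2)\<close> as \<open>t\<close> tends to \<open>0\<close>.\<close>

lemma (in prob_space) subgaussian_rel_mean_zero:
  assumes Z: "subgaussian_rel M \<rho> Z"
  shows "integrable M Z" "expectation Z = 0"
proof -
  have [measurable]: "Z \<in> borel_measurable M" and sq: "integrable M (\<lambda>x. (Z x)\<^sup>2)"
    using Z by (auto simp: subgaussian_rel_def)
  show int: "integrable M Z"
    by (rule square_integrable_imp_integrable[OF _ sq]) simp
  define \<mu> where "\<mu> = expectation Z"
  define c where "c = \<rho>\<^sup>2 * expectation (\<lambda>x. (Z x)\<^sup>2) / 2"
  have c: "c \<ge> 0" by (auto simp: c_def intro!: mult_nonneg_nonneg integral_nonneg_AE)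
  have le: "t * \<mu> \<le> 2 * (t\<^sup>2 * c)" if t: "t\<^sup>2 * c \<le> 1" for t
  proof -
    have "1 + t * \<mu> = expectation (\<lambda>x. 1 + t * Z x)"
      using int by (simp add: \<mu>_def prob_space)
    also have "\<dots> \<le> expectation (\<lambda>x. exp (t * Z x))"
      using Z int by (intro integral_mono exp_ge_add_one_self) (auto simp: subgaussian_rel_def)
    also have "\<dots> \<le> exp (t\<^sup>2 * c)"
      using Z by (simp add: subgaussian_rel_def c_def mult.assoc)
    also have "\<dots> \<le> 1 + t\<^sup>2 * c + (t\<^sup>2 * c)\<^sup>2"
      using t c by (intro exp_bound) auto
    also have "(t\<^sup>2 * c)\<^sup>2 \<le> t\<^sup>2 * c"
      unfolding power2_eq_square[of "t\<^sup>2 * c"] using t c by (intro mult_left_le) auto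
    finally show ?thesis by linarith
  qed
  have "\<mu> = 0"
  proof (rule ccontr)
    assume nz: "\<mu> \<noteq> 0"
    \<comment> \<open>Taking t = x * \<mu> replaces the limit: x is small enough for
      \<open>le\<close> to apply, and \<open>le\<close> would then force 1 \<le> 2 * x * c.\<close>
    define x where "x = 1 / (1 + 2 * c + \<mu>\<^sup>2)"
    have den: "1 + 2 * c + \<mu>\<^sup>2 > 0" using c by (intro add_pos_nonneg) auto
    have x: "x > 0" "2 * (x * c) < 1" "x * \<mu>\<^sup>2 \<le> 1"
      using den c by (auto simp: x_def field_simps add_pos_nonneg)
    have "(x * \<mu>\<^sup>2) * (x * c) \<le> 1 * 1"
      using x c by (intro mult_mono) auto
    then have "(x * \<mu>)\<^sup>2 * c \<le> 1" by (simp add: power2_eq_square mult_ac)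
    from le[OF this] have "(x * \<mu>\<^sup>2) * 1 \<le> (x * \<mu>\<^sup>2) * (2 * (x * c))"
      by (simp add: power2_eq_square mult_ac)
    moreover have "x * \<mu>\<^sup>2 > 0" using x nz by simp
    ultimately show False using x(2) by (simp only: mult_le_cancel_left_pos)
  qed
  then show "expectation Z = 0" by (simp add: \<mu>_def)
qed

section \<open>Orthonormal coordinates and the Gram matrix\<close>

lemma orthonormal_expansion:
  assumes orth: "\<forall>i<d. \<forall>j<d. dotp d (a i) (a j) = (if i = j then 1 else 0)" and "k < d"
  shows "(\<Sum>i<d. a i k * dotp d (a i) x) = x k"
proof -
  have "(\<Sum>i<d. a i k * dotp d (a i) x) = (\<Sum>i<d. \<Sum>l<d. (a i k * a i l) * x l)"
    by (simp add: dotp_def sum_distrib_left mult.assoc)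
  also have "\<dots> = (\<Sum>l<d. (\<Sum>i<d. a i k * a i l) * x l)"
    unfolding sum_distrib_right by (rule sum.swap)
  also have "\<dots> = (\<Sum>l<d. if l = k then x k else 0)"
    using orthonormal_columns[OF orth] assms(2) by (intro sum.cong) auto
  finally show ?thesis using assms(2) by simp
qed

lemma orthonormal_Parseval:
  assumes orth: "\<forall>i<d. \<forall>j<d. dotp d (a i) (a j) = (if i = j then 1 else 0)"
  shows "(\<Sum>i<d. dotp d (a i) x * dotp d (a i) y) = dotp d x y"
proof -
  have "(\<Sum>i<d. dotp d (a i) x * dotp d (a i) y) = (\<Sum>i<d. \<Sum>k<d. x k * (a i k * dotp d (a i) y))"
    unfolding dotp_def[of d _ x] sum_distrib_right by (intro sum.cong refl) (simp add: mult_ac)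
  also have "\<dots> = (\<Sum>k<d. x k * (\<Sum>i<d. a i k * dotp d (a i) y))"
    unfolding sum_distrib_left by (rule sum.swap)
  also have "\<dots> = dotp d x y"
    unfolding dotp_def[of d x] by (intro sum.cong refl) (simp add: orthonormal_expansion[OF orth])
  finally show ?thesis .
qed

lemma gram_quadratic_form:
  assumes orth: "\<forall>i<d. \<forall>j<d. dotp d (a i) (a j) = (if i = j then 1 else 0)"
  shows "(\<Sum>i<m. \<Sum>j<m. v i * gram d S i j * v j) = (\<Sum>k<d. (\<Sum>j<m. v j * dotp d (a k) (S j))\<^sup>2)"
proof -
  have "(\<Sum>k<d. (\<Sum>j<m. v j * dotp d (a k) (S j))\<^sup>2)
      = (\<Sum>k<d. \<Sum>i<m. \<Sum>j<m. v i * v j * (dotp d (a k) (S i) * dotp d (a k) (S j)))"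
    by (simp add: power2_eq_square sum_product mult_ac)
  also have "\<dots> = (\<Sum>i<m. \<Sum>j<m. \<Sum>k<d. v i * v j * (dotp d (a k) (S i) * dotp d (a k) (S j)))"
    by (subst sum.swap) (intro sum.cong refl sum.swap)
  also have "\<dots> = (\<Sum>i<m. \<Sum>j<m. v i * gram d S i j * v j)"
    unfolding sum_distrib_left[symmetric] orthonormal_Parseval[OF orth] gram_def
    by (simp add: mult_ac)
  finally show ?thesis ..
qed

text \<open>The variational characterization writes the event as an intersection over all vectors v.
  The conditions are closed in v by continuity, so a countable dense set of vectors
  suffices.\<close>

lemma sets_lambda_min_gram_ge:
  assumes "m \<ge> 1" and sets: "sets D = sets (PiM {..<d} (\<lambda>_. borel :: real measure))"
  shows "{S \<in> space (PiM {..<m} (\<lambda>_. D)). c \<le> lambda_min m (gram d S)} \<in> sets (PiM {..<m} (\<lambda>_. D))"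
proof -
  let ?P = "PiM {..<m} (\<lambda>_. D)"
  define f where "f S v = (\<Sum>i<m. \<Sum>j<m. v i * gram d S i j * v j) - c * (\<Sum>i<m. (v i)\<^sup>2)"
    for S and v :: "nat \<Rightarrow> real"
  obtain V :: "(nat \<Rightarrow> real) set" where V: "countable V"
    and dense: "\<And>X. open X \<Longrightarrow> X \<noteq> {} \<Longrightarrow> \<exists>v\<in>V. v \<in> X"
    using countable_dense_setE by metis
  have dense_iff: "(\<forall>v. 0 \<le> f S v) \<longleftrightarrow> (\<forall>v\<in>V. 0 \<le> f S v)" for S
  proof
    assume *: "\<forall>v\<in>V. 0 \<le> f S v"
    have "open {v. f S v < 0}"
      unfolding f_def by (intro open_Collect_less continuous_intros
        continuous_on_quadratic_form continuous_on_square_norm)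
    then have "{v. f S v < 0} = {}" using dense[of "{v. f S v < 0}"] * by force
    then show "\<forall>v. 0 \<le> f S v" by (auto simp: not_less)
  qed blast
  have "c \<le> lambda_min m (gram d S) \<longleftrightarrow> (\<forall>v\<in>V. 0 \<le> f S v)" for S
  proof -
    have "c \<le> lambda_min m (gram d S) \<longleftrightarrow> (\<forall>v. 0 \<le> f S v)"
      unfolding f_def diff_ge_0_iff_ge
      by (rule lambda_min_ge_iff[OF assms(1)]) (simp add: gram_def dotp_def mult.commute)
    then show ?thesis unfolding dense_iff .
  qed
  then have eq: "{S \<in> space ?P. c \<le> lambda_min m (gram d S)} = {S \<in> space ?P. \<forall>v\<in>V. 0 \<le> f S v}"
    by simp
  have coord: "(\<lambda>S. S i k) \<in> borel_measurable ?P" if "i < m" "k < d" for i k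
  proof -
    have "(\<lambda>x. x k) \<in> borel_measurable D"
      using that unfolding measurable_cong_sets[OF sets refl] by simp
    then show ?thesis
      using that by (intro measurable_compose[OF measurable_component_singleton[of i "{..<m}" "\<lambda>_. D"]]) auto
  qed
  have [measurable]: "(\<lambda>S. f S v) \<in> borel_measurable ?P" for v
    unfolding f_def gram_def dotp_def
    by (intro borel_measurable_diff borel_measurable_const borel_measurable_sum
      borel_measurable_times coord) auto
  have "V \<noteq> {}" using dense[of UNIV] by blast
  then have "V = range (from_nat_into V)" using V by (simp add: range_from_nat_into)
  then have "(\<forall>v\<in>V. 0 \<le> f S v) \<longleftrightarrow> (\<forall>n. 0 \<le> f S (from_nat_into V n))" for S
    by (metis rangeE rangeI)
  then show ?thesis
    unfolding eq by simp
qed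

locale subgaussian_sample =
  fixes \<rho> :: real and d :: nat and D :: "(nat \<Rightarrow> real) measure" and a :: "nat \<Rightarrow> nat \<Rightarrow> real"
  assumes rho: "\<rho> > 0"
    and distr: "distr_Rd d D"
    and orth: "\<forall>i<d. \<forall>j<d. dotp d (a i) (a j) = (if i = j then 1 else 0)"
    and indep: "prob_space.indep_vars D (\<lambda>_. borel) (\<lambda>i x. dotp d (a i) x) {..<d}"
    and subg: "\<forall>i<d. subgaussian_rel D \<rho> (\<lambda>x. dotp d (a i) x)"
    and cov_le: "loewner_le_id d (covmat D)"
begin

sublocale D: prob_space D
  using distr by (simp add: distr_Rd_def)

abbreviation Z :: "nat \<Rightarrow> (nat \<Rightarrow> real) \<Rightarrow> real" where
  "Z i x \<equiv> dotp d (a i) x"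

text \<open>A second moment, equal to the variance because of \<open>Z_mean\<close>.\<close>

definition lam :: "nat \<Rightarrow> real" where
  "lam i = D.expectation (\<lambda>x. (Z i x)\<^sup>2)"

definition T :: real where
  "T = (\<Sum>i<d. lam i)"

lemma Z_measurable: "i < d \<Longrightarrow> (\<lambda>x. Z i x) \<in> borel_measurable D"
  and Z_square_integrable: "i < d \<Longrightarrow> integrable D (\<lambda>x. (Z i x)\<^sup>2)"
  using subg by (auto simp: subgaussian_rel_def)

lemma Z_integrable: "i < d \<Longrightarrow> integrable D (Z i)"
  and Z_mean: "i < d \<Longrightarrow> D.expectation (Z i) = 0"
  using D.subgaussian_rel_mean_zero subg by blast+

lemma coord_eq: "k < d \<Longrightarrow> x k = (\<Sum>i<d. a i k * Z i x)"
  using orthonormal_expansion[OF orth] by simp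

lemma Z_product_integrable:
  assumes "i < d" "j < d"
  shows "integrable D (\<lambda>x. Z i x * Z j x)"
proof (rule Bochner_Integration.integrable_bound)
  show "integrable D (\<lambda>x. (Z i x)\<^sup>2 + (Z j x)\<^sup>2)"
    using Z_square_integrable assms by auto
  show "(\<lambda>x. Z i x * Z j x) \<in> borel_measurable D"
    using Z_measurable assms by auto
  have "\<bar>y * z\<bar> \<le> y\<^sup>2 + z\<^sup>2" for y z :: real
  proof -
    have "2 * \<bar>y * z\<bar> \<le> y\<^sup>2 + z\<^sup>2"
      using sum_squares_bound[of "\<bar>y\<bar>" "\<bar>z\<bar>"] by (simp add: abs_mult mult.assoc)
    then show ?thesis using abs_ge_zero[of "y * z"] by linarith
  qed
  then show "AE x in D. norm (Z i x * Z j x) \<le> norm ((Z i x)\<^sup>2 + (Z j x)\<^sup>2)"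
    by (auto intro: order_trans)
qed

text \<open>Needed to exchange sums with the integrals in \<open>covmat\<close>: independence and
  integrability are given in the basis \<open>a\<close>, while \<open>covmat\<close> uses the
  original coordinates.\<close>

lemma coord_product_integrable:
  assumes "k < d" "l < d"
  shows "integrable D (\<lambda>x. x k * x l)"
proof -
  have "x k * x l = (\<Sum>i<d. \<Sum>j<d. a i k * a j l * (Z i x * Z j x))" for x
    unfolding coord_eq[OF assms(1), of x] coord_eq[OF assms(2), of x] sum_product
    by (intro sum.cong refl) (simp add: mult_ac)
  then show ?thesis
    by (simp only:) (intro Bochner_Integration.integrable_sum integrable_mult_right Z_product_integrable; simp)
qed

lemma coord_mean:
  assumes "k < d"
  shows "D.expectation (\<lambda>x. x k) = 0"
proof -
  have "D.expectation (\<lambda>x. x k) = D.expectation (\<lambda>x. \<Sum>i<d. a i k * Z i x)"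
    using coord_eq[OF assms] by (intro Bochner_Integration.integral_cong refl)
  also have "\<dots> = (\<Sum>i<d. D.expectation (\<lambda>x. a i k * Z i x))"
    by (intro Bochner_Integration.integral_sum integrable_mult_right Z_integrable) simp
  also have "\<dots> = 0" by (simp add: Z_mean)
  finally show ?thesis .
qed

lemma covmat_eq: "k < d \<Longrightarrow> covmat D k l = D.expectation (\<lambda>x. x k * x l)"
  by (simp add: covmat_def coord_mean)

text \<open>\<open>lam i\<close> is the quadratic form of the covariance matrix at the unit vector
  \<open>a i\<close>.\<close>

lemma lam_le_1:
  assumes "i < d"
  shows "lam i \<le> 1"
proof -
  have "lam i = D.expectation (\<lambda>x. \<Sum>j<d. \<Sum>k<d. a i j * a i k * (x j * x k))"
    unfolding lam_def by (simp add: dotp_def power2_eq_square sum_product mult_ac)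
  also have "\<dots> = (\<Sum>j<d. D.expectation (\<lambda>x. \<Sum>k<d. a i j * a i k * (x j * x k)))"
    by (intro Bochner_Integration.integral_sum Bochner_Integration.integrable_sum
      integrable_mult_right coord_product_integrable; simp)
  also have "\<dots> = (\<Sum>j<d. \<Sum>k<d. D.expectation (\<lambda>x. a i j * a i k * (x j * x k)))"
    by (intro sum.cong refl Bochner_Integration.integral_sum
      integrable_mult_right coord_product_integrable; simp)
  also have "\<dots> = (\<Sum>j<d. \<Sum>k<d. a i j * a i k * covmat D j k)"
    by (intro sum.cong refl) (simp add: covmat_eq)
  also have "\<dots> = (\<Sum>j<d. \<Sum>k<d. a i j * covmat D j k * a i k)"
    by (simp add: mult_ac)
  also have "\<dots> \<le> (\<Sum>j<d. (a i j)\<^sup>2)"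
    using cov_le by (simp add: loewner_le_id_def)
  also have "\<dots> = 1" using orth assms by (auto simp: dotp_def power2_eq_square)
  finally show ?thesis .
qed

lemma lam_nonneg: "0 \<le> lam i"
  unfolding lam_def by (intro integral_nonneg_AE) auto

lemma T_nonneg: "0 \<le> T"
  unfolding T_def by (intro sum_nonneg lam_nonneg)

text \<open>Both sides are the expected squared norm of x, computed in the original coordinates and
  in the basis \<open>a\<close>.\<close>

lemma trace_covmat: "trace_mat d (covmat D) = T"
proof -
  have "trace_mat d (covmat D) = (\<Sum>k<d. D.expectation (\<lambda>x. x k * x k))"
    unfolding trace_mat_def by (intro sum.cong refl covmat_eq) simp
  also have "\<dots> = D.expectation (\<lambda>x. dotp d x x)"
    unfolding dotp_def by (intro Bochner_Integration.integral_sum[symmetric] coord_product_integrable; simp)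
  also have "\<dots> = D.expectation (\<lambda>x. \<Sum>i<d. Z i x * Z i x)"
    by (simp only: orthonormal_Parseval[OF orth])
  also have "\<dots> = (\<Sum>i<d. D.expectation (\<lambda>x. Z i x * Z i x))"
    by (intro Bochner_Integration.integral_sum Z_product_integrable; simp)
  finally show ?thesis by (simp add: T_def lam_def power2_eq_square)
qed

section \<open>Tails for a fixed vector and the union bound\<close>

definition Q :: "nat \<Rightarrow> (nat \<Rightarrow> real) \<Rightarrow> (nat \<Rightarrow> nat \<Rightarrow> real) \<Rightarrow> real" where
  "Q m v S = (\<Sum>i<d. (\<Sum>j<m. v j * Z i (S j))\<^sup>2)"

definition P :: "nat \<Rightarrow> (nat \<Rightarrow> nat \<Rightarrow> real) measure" where
  "P m = PiM {..<m} (\<lambda>_. D)"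

lemma prob_space_P: "prob_space (P m)"
  unfolding P_def by (intro prob_space_PiM D.prob_space_axioms)

lemma combination_proxy:
  assumes "i < d"
  shows "subgaussian_proxy (P m) (\<rho>\<^sup>2 * ((\<Sum>j<m. (v j)\<^sup>2) * lam i)) (\<lambda>S. \<Sum>j<m. v j * Z i (S j))"
  using subgaussian_proxy_sample_combination[OF D.prob_space_axioms
      subgaussian_rel_imp_proxy[OF subg[rule_format, OF assms]], of m v]
  by (simp add: P_def lam_def mult_ac)

lemma combination_variance_le_1:
  assumes "i < d" "(\<Sum>j<m. (v j)\<^sup>2) \<le> 1"
  shows "0 \<le> (\<Sum>j<m. (v j)\<^sup>2) * lam i \<and> (\<Sum>j<m. (v j)\<^sup>2) * lam i \<le> 1"
  using assms lam_le_1 lam_nonneg by (auto intro!: mult_le_one mult_nonneg_nonneg sum_nonneg)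

lemma Q_measurable: "Q m v \<in> borel_measurable (P m)"
proof -
  have "(\<lambda>S. \<Sum>j<m. v j * Z i (S j)) \<in> borel_measurable (P m)" if "i < d" for i
    using combination_proxy[OF that] by (simp add: subgaussian_proxy_def)
  then show ?thesis
    unfolding Q_def by (rule borel_measurable_sum[OF borel_measurable_power]) simp
qed

lemma Q_upper_tail:
  assumes "(\<Sum>j<m. (v j)\<^sup>2) \<le> 1"
  shows "measure (P m) {S \<in> space (P m). 4 * \<rho>\<^sup>2 * T \<le> Q m v S} \<le> exp (- T / 2)"
  unfolding Q_def
proof (rule prob_space.sum_squares_upper_tail[OF prob_space_P,
    where \<Lambda> = "\<lambda>i. (\<Sum>j<m. (v j)\<^sup>2) * lam i"])
  show "prob_space.indep_vars (P m) (\<lambda>_. borel) (\<lambda>i S. \<Sum>j<m. v j * Z i (S j)) {..<d}"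
    unfolding P_def by (rule indep_vars_sample_combination[OF D.prob_space_axioms indep])
  show "(\<Sum>i<d. (\<Sum>j<m. (v j)\<^sup>2) * lam i) \<le> T"
    unfolding T_def by (intro sum_mono mult_left_le_one_le lam_nonneg assms sum_nonneg) auto
  show "0 \<le> (\<Sum>j<m. (v j)\<^sup>2) * lam i \<and> (\<Sum>j<m. (v j)\<^sup>2) * lam i \<le> 1" if "i \<in> {..<d}" for i
    using combination_variance_le_1[OF _ assms(1)] that by blast
qed (use rho combination_proxy in auto)

lemma Q_lower_tail:
  assumes "(\<Sum>j<m. (v j)\<^sup>2) \<le> 1" "1 / 4 \<le> (\<Sum>j<m. (v j)\<^sup>2)"
  shows "measure (P m) {S \<in> space (P m). Q m v S \<le> T / 16} \<le> exp (- T / (16384 * (\<rho>\<^sup>2)\<^sup>2))"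
  unfolding Q_def
proof (rule prob_space.sum_squares_lower_tail[OF prob_space_P,
    where \<Lambda> = "\<lambda>i. (\<Sum>j<m. (v j)\<^sup>2) * lam i"])
  show "prob_space.indep_vars (P m) (\<lambda>_. borel) (\<lambda>i S. \<Sum>j<m. v j * Z i (S j)) {..<d}"
    unfolding P_def by (rule indep_vars_sample_combination[OF D.prob_space_axioms indep])
  show "T / 4 \<le> (\<Sum>i<d. (\<Sum>j<m. (v j)\<^sup>2) * lam i)"
  proof -
    have "1 / 4 * T \<le> (\<Sum>j<m. (v j)\<^sup>2) * T"
      by (rule mult_right_mono[OF assms(2) T_nonneg])
    also have "\<dots> = (\<Sum>i<d. (\<Sum>j<m. (v j)\<^sup>2) * lam i)"
      by (simp only: T_def sum_distrib_left)
    finally show ?thesis by simp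
  qed
  fix i assume "i \<in> {..<d}"
  then have i: "i < d" by simp
  show "0 \<le> (\<Sum>j<m. (v j)\<^sup>2) * lam i \<and> (\<Sum>j<m. (v j)\<^sup>2) * lam i \<le> 1"
    by (rule combination_variance_le_1[OF i assms(1)])
  show "integrable (P m) (\<lambda>S. (\<Sum>j<m. v j * Z i (S j))\<^sup>2)"
    unfolding P_def by (rule second_moment_sample_combination)
      (simp_all add: i D.prob_space_axioms Z_measurable Z_integrable Z_square_integrable Z_mean)
  show "(\<integral>S. (\<Sum>j<m. v j * Z i (S j))\<^sup>2 \<partial>P m) = (\<Sum>j<m. (v j)\<^sup>2) * lam i"
    unfolding P_def lam_def by (rule second_moment_sample_combination)
      (simp_all add: i D.prob_space_axioms Z_measurable Z_integrable Z_square_integrable Z_mean)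
qed (use rho combination_proxy in auto)

text \<open>The complement supplies the two net hypotheses of
  \<open>image_norm_ge_net_bound\<close>. The lower event is restricted to net points of norm at
  least 1/2, since the image of a point near the origin is small with high probability.\<close>

definition bad :: "nat \<Rightarrow> real \<Rightarrow> (nat \<Rightarrow> nat \<Rightarrow> real) set" where
  "bad m \<epsilon> = (\<Union>k\<in>lattice_ball m (real m / \<epsilon>\<^sup>2).
     {S \<in> space (P m). 4 * \<rho>\<^sup>2 * T \<le> Q m (net_point m \<epsilon> k) S} \<union>
     {S \<in> space (P m). 1 / 4 \<le> (\<Sum>j<m. (net_point m \<epsilon> k j)\<^sup>2) \<and> Q m (net_point m \<epsilon> k) S \<le> T / 16})"

lemma bad_sets: "bad m \<epsilon> \<in> sets (P m)"
proof -
  note [measurable] = Q_measurable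
  show ?thesis
    unfolding bad_def by (intro sets.finite_UN lattice_ball_finite_card) measurable
qed

text \<open>\<open>c\<close> is a rate below both tail exponents, and the factor 2 counts the two
  events at each net point.\<close>

lemma prob_bad_le:
  assumes "m \<ge> 1" "\<epsilon> > 0"
    and c: "c \<le> 1 / 2" "c \<le> 1 / (16384 * (\<rho>\<^sup>2)\<^sup>2)"
  shows "measure (P m) (bad m \<epsilon>) \<le> exp (real m / \<epsilon>\<^sup>2) * 3 ^ m * (2 * exp (- c * T))"
proof -
  interpret P: prob_space "P m" by (rule prob_space_P)
  note [measurable] = Q_measurable
  let ?U = "\<lambda>k. {S \<in> space (P m). 4 * \<rho>\<^sup>2 * T \<le> Q m (net_point m \<epsilon> k) S}"
  let ?L = "\<lambda>k. {S \<in> space (P m). 1 / 4 \<le> (\<Sum>j<m. (net_point m \<epsilon> k j)\<^sup>2) \<and> Q m (net_point m \<epsilon> k) S \<le> T / 16}"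
  have each: "P.prob (?U k \<union> ?L k) \<le> 2 * exp (- c * T)"
    if k: "k \<in> lattice_ball m (real m / \<epsilon>\<^sup>2)" for k
  proof -
    note n1 = net_point_norm_le[OF assms(1,2) k]
    have "P.prob (?U k) \<le> exp (- T / 2)" by (rule Q_upper_tail[OF n1])
    also have "\<dots> \<le> exp (- c * T)"
      using mult_right_mono[OF c(1) T_nonneg] by simp
    finally have U: "P.prob (?U k) \<le> exp (- c * T)" .
    have L: "P.prob (?L k) \<le> exp (- c * T)"
    proof (cases "1 / 4 \<le> (\<Sum>j<m. (net_point m \<epsilon> k j)\<^sup>2)")
      case True
      then have "P.prob (?L k) \<le> exp (- T / (16384 * (\<rho>\<^sup>2)\<^sup>2))"
        using Q_lower_tail[OF n1] by simp
      also have "\<dots> \<le> exp (- c * T)"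
        using mult_right_mono[OF c(2) T_nonneg] by simp
      finally show ?thesis .
    qed simp
    have "P.prob (?U k \<union> ?L k) \<le> P.prob (?U k) + P.prob (?L k)"
      by (rule measure_Un_le) measurable
    then show ?thesis using U L by linarith
  qed
  have "P.prob (bad m \<epsilon>) \<le> (\<Sum>k\<in>lattice_ball m (real m / \<epsilon>\<^sup>2). P.prob (?U k \<union> ?L k))"
    unfolding bad_def
    by (intro measure_UNION_le lattice_ball_finite_card) measurable
  also have "\<dots> \<le> (\<Sum>k\<in>lattice_ball m (real m / \<epsilon>\<^sup>2). 2 * exp (- c * T))"
    by (intro sum_mono each)
  also have "\<dots> = real (card (lattice_ball m (real m / \<epsilon>\<^sup>2))) * (2 * exp (- c * T))"
    by simp
  also have "\<dots> \<le> exp (real m / \<epsilon>\<^sup>2) * 3 ^ m * (2 * exp (- c * T))"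
    by (intro mult_right_mono lattice_ball_finite_card) auto
  finally show ?thesis .
qed

lemma lambda_min_ge_outside_bad:
  assumes "m \<ge> 1" "0 < \<epsilon>" "\<epsilon> \<le> 1 / 2" "\<epsilon> * \<rho> \<le> 1 / 32"
    and S: "S \<in> space (P m)" "S \<notin> bad m \<epsilon>"
  shows "T / 64 \<le> lambda_min m (gram d S)"
proof -
  let ?Y = "\<lambda>i j. Z i (S j)"
  have Q: "Q m v S = (image_norm d m ?Y v)\<^sup>2" for v
    by (simp add: Q_def image_norm_square)
  have upper: "image_norm d m ?Y (net_point m \<epsilon> k) \<le> 2 * \<rho> * sqrt T"
    if "k \<in> lattice_ball m (real m / \<epsilon>\<^sup>2)" for k
  proof (rule power2_le_imp_le)
    have "Q m (net_point m \<epsilon> k) S < 4 * \<rho>\<^sup>2 * T"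
      using S that unfolding bad_def by (auto simp: not_le)
    then show "(image_norm d m ?Y (net_point m \<epsilon> k))\<^sup>2 \<le> (2 * \<rho> * sqrt T)\<^sup>2"
      using T_nonneg by (simp add: Q power_mult_distrib)
  qed (use rho T_nonneg in auto)
  have lower: "sqrt T / 4 \<le> image_norm d m ?Y (net_point m \<epsilon> k)"
    if "k \<in> lattice_ball m (real m / \<epsilon>\<^sup>2)" "1 / 4 \<le> (\<Sum>j<m. (net_point m \<epsilon> k j)\<^sup>2)" for k
  proof (rule power2_le_imp_le)
    have "T / 16 < Q m (net_point m \<epsilon> k) S"
      using S that unfolding bad_def by (auto simp: not_le)
    then show "(sqrt T / 4)\<^sup>2 \<le> (image_norm d m ?Y (net_point m \<epsilon> k))\<^sup>2"
      using T_nonneg by (simp add: Q power_divide)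
  qed (simp add: image_norm_nonneg)
  have "T / 64 * (\<Sum>j<m. (v j)\<^sup>2) \<le> Q m v S" for v
  proof -
    \<comment> \<open>By \<epsilon> * \<rho> \<le> 1/32 the loss 4 * \<epsilon> * \<rho> * sqrt T is
      at most half of sqrt T / 4; squaring what remains gives T / 64.\<close>
    have "sqrt T / 8 \<le> sqrt T / 4 - 2 * \<epsilon> * (2 * \<rho> * sqrt T)"
      using mult_right_mono[OF assms(4), of "sqrt T"] T_nonneg by (simp add: mult_ac)
    then have "sqrt T / 8 * L2_set v {..<m} \<le> (sqrt T / 4 - 2 * \<epsilon> * (2 * \<rho> * sqrt T)) * L2_set v {..<m}"
      by (intro mult_right_mono L2_set_nonneg)
    also have "\<dots> \<le> image_norm d m ?Y v"
      by (rule image_norm_ge_net_bound[OF assms(1-3) upper lower])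
    finally have "(sqrt T / 8 * L2_set v {..<m})\<^sup>2 \<le> (image_norm d m ?Y v)\<^sup>2"
      using T_nonneg by (intro power_mono) auto
    then show ?thesis
      using T_nonneg by (simp add: Q power_mult_distrib power_divide L2_set_def sum_nonneg)
  qed
  then show ?thesis
    by (subst lambda_min_ge_iff[OF assms(1)])
      (simp_all add: gram_quadratic_form[OF orth] Q_def, simp add: gram_def dotp_def mult.commute)
qed

end

theorem mainTheorem16:
  fixes \<rho> \<delta> :: real
  assumes "\<rho> > 0" and "0 < \<delta>" and "\<delta> < 1"
  shows "\<exists>\<beta> C :: real. \<beta> > 0 \<and> C > 0 \<and>
    (\<forall>(d::nat) (D :: (nat \<Rightarrow> real) measure) (m::nat).
       subgaussian_product \<rho> d D \<longrightarrow> loewner_le_id d (covmat D) \<longrightarrow>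
       1 \<le> m \<longrightarrow> real m \<le> \<beta> * trace_mat d (covmat D) - C \<longrightarrow>
       measure (PiM {..<m} (\<lambda>_. D))
         {S \<in> space (PiM {..<m} (\<lambda>_. D)). lambda_min m (gram d S) \<ge> real m} \<ge> \<delta>)"
proof -
  define \<epsilon> where "\<epsilon> = min (1 / 2) (1 / (32 * \<rho>))"
  \<comment> \<open>The net has at most exp (\<kappa> * m) points.\<close>
  define \<kappa> where "\<kappa> = 1 / \<epsilon>\<^sup>2 + ln 3"
  define c where "c = min (1 / 2) (1 / (16384 * (\<rho>\<^sup>2)\<^sup>2))"
  \<comment> \<open>The bound 1/64 turns the eigenvalue bound T / 64 into m; the bound c / \<kappa>
    lets the tail decay exp (- c T) absorb the size of the net.\<close>
  define \<beta> where "\<beta> = min (1 / 64) (c / \<kappa>)"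
  \<comment> \<open>Subtracting C lowers the exponent by \<kappa> * C = ln (2 / (1 - \<delta>)),
    which leaves failure probability at most 1 - \<delta>.\<close>
  define C where "C = ln (2 / (1 - \<delta>)) / \<kappa>"
  have \<epsilon>: "0 < \<epsilon>" "\<epsilon> \<le> 1 / 2" using assms(1) by (auto simp: \<epsilon>_def)
  have "\<epsilon> * \<rho> \<le> 1 / (32 * \<rho>) * \<rho>"
    using assms(1) by (intro mult_right_mono) (auto simp: \<epsilon>_def)
  then have \<epsilon>\<rho>: "\<epsilon> * \<rho> \<le> 1 / 32" using assms(1) by simp
  have \<kappa>: "\<kappa> > 0" unfolding \<kappa>_def using \<epsilon> by (intro add_pos_pos) auto
  have c: "c > 0" using assms(1) by (auto simp: c_def)
  have \<beta>: "\<beta> > 0" "\<beta> \<le> 1 / 64" "\<kappa> * \<beta> \<le> c"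
    using c \<kappa> by (auto simp: \<beta>_def min_def field_simps)
  have C: "C > 0" using assms \<kappa> by (auto simp: C_def intro!: divide_pos_pos ln_gt_zero)
  have "\<delta> \<le> measure (PiM {..<m} (\<lambda>_. D))
      {S \<in> space (PiM {..<m} (\<lambda>_. D)). lambda_min m (gram d S) \<ge> real m}"
    if prod: "subgaussian_product \<rho> d D" and cov: "loewner_le_id d (covmat D)"
      and m: "1 \<le> m" and le: "real m \<le> \<beta> * trace_mat d (covmat D) - C"
    for d m and D :: "(nat \<Rightarrow> real) measure"
  proof -
    obtain a where "subgaussian_sample \<rho> d D a"
      using prod cov assms(1) by (auto simp: subgaussian_product_def subgaussian_sample_def)
    then interpret subgaussian_sample \<rho> d D a .
    interpret P: prob_space "P m" by (rule prob_space_P)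
    have le: "real m \<le> \<beta> * T - C" using le by (simp add: trace_covmat)
    have mT: "real m \<le> T / 64"
      using le C mult_right_mono[OF \<beta>(2) T_nonneg] by simp
    have "\<kappa> * real m - c * T \<le> \<kappa> * (\<beta> * T - C) - \<kappa> * \<beta> * T"
      using le \<kappa> T_nonneg \<beta>(3) by (intro diff_mono mult_left_mono mult_right_mono) auto
    also have "\<dots> = - ln (2 / (1 - \<delta>))"
      using \<kappa> by (simp add: C_def algebra_simps)
    finally have expo: "\<kappa> * real m - c * T \<le> - ln (2 / (1 - \<delta>))" .
    have "P.prob (bad m \<epsilon>) \<le> exp (real m / \<epsilon>\<^sup>2) * 3 ^ m * (2 * exp (- c * T))"
      using m \<epsilon> by (intro prob_bad_le) (auto simp: c_def)
    also have "\<dots> = 2 * exp (\<kappa> * real m - c * T)"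
    proof -
      have "(3::real) ^ m = exp (real m * ln 3)"
        by (simp add: exp_of_nat_mult)
      then show ?thesis
        by (simp add: \<kappa>_def exp_diff exp_add exp_minus field_simps)
    qed
    also have "\<dots> \<le> 2 * exp (- ln (2 / (1 - \<delta>)))"
      using expo by simp
    also have "\<dots> = 1 - \<delta>"
      using assms by (simp add: exp_minus)
    finally have bad: "P.prob (bad m \<epsilon>) \<le> 1 - \<delta>" .
    have "\<delta> \<le> 1 - P.prob (bad m \<epsilon>)" using bad by simp
    also have "\<dots> = P.prob (space (P m) - bad m \<epsilon>)"
      by (rule P.prob_compl[OF bad_sets, symmetric])
    also have "\<dots> \<le> P.prob {S \<in> space (P m). real m \<le> lambda_min m (gram d S)}"
    proof (rule P.finite_measure_mono)
      show "space (P m) - bad m \<epsilon> \<subseteq> {S \<in> space (P m). real m \<le> lambda_min m (gram d S)}"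
        using lambda_min_ge_outside_bad[OF m \<epsilon> \<epsilon>\<rho>] mT by force
      show "{S \<in> space (P m). real m \<le> lambda_min m (gram d S)} \<in> P.events"
        unfolding P_def using distr by (intro sets_lambda_min_gram_ge m) (simp add: distr_Rd_def)
    qed
    finally show ?thesis by (simp add: P_def)
  qed
  then show ?thesis using \<beta>(1) C by blast
qed

end
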